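(* Let $\mu_1,\mu_2$ be two probability measures on $\mathbb{R}$ having smooth positive densities $f_{\mu_1}, f_{\mu_2}$. For $i=1,2$ let $F_{\mu_i}(x) = \mu_i((-\infty,x])$ and set $\mathcal{I}^\flat_{\mu_i} := f_{\mu_i}\circ F_{\mu_i}^{-1} : [0,1]\to\mathbb{R}_+$. Let $L>0$. If \[ \mathcal{I}^\flat_{\mu_2} \geq \frac{1}{L}\,\mathcal{I}^\flat_{\mu_1} \quad \text{on } [0,1], \] then \[ \forall k \geq 1 \quad \lambda_k(\mathbb{R},|\cdot|,\mu_2) \geq \frac{1}{L^2}\,\lambda_k(\mathbb{R},|\cdot|,\mu_1). \]
   Context: The function $\mathcal{I}^\flat_\mu$ is called the one-sided flat isoperimetric profile of $\mu$; at the endpoints $v\in\{0,1\}$ (where $F_\mu^{-1}(v)=\mp\infty$) it is set to be $0$, so that the hypothesis only concerns $v \in (0,1)$. For a measure $\mu = \exp(-V(x))\,dx$ on $\mathbb{R}$ with $V$ smooth, $\Delta_\mu f = f'' - V' f'$. The operator $-\Delta_\mu$ is positive semi-definite and essentially self-adjoint on $C_c^\infty(\mathbb{R})\subset L^2(\mu)$; the same notation is used for its unique self-adjoint extension. Let $\{E_\lambda\}$ be its spectral decomposition of identity ($E_\lambda$ is the spectral projection onto $(-\infty,\lambda]$). One sets \[ \lambda_k(\mathbb{R},|\cdot|,\mu) := \sup\{\lambda\in\mathbb{R} : \dim(\mathrm{Im}(E_\lambda))<k\}; \] when the spectrum is discrete these are the eigenvalues of $-\Delta_\mu$ in non-decreasing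 order, repeated by multiplicity. *)

theory Defs
  imports "HOL-Probability.Probability"
begin

section \<open>The Hilbert space of square-integrable functions\<close>

text \<open>
  Elements of the real Hilbert space \<open>L\<^sup>2(M)\<close> are represented by functions; equality in the
  Hilbert space is equality almost everywhere, and is written out wherever it is meant.
\<close>

definition L2_space :: "'a measure \<Rightarrow> ('a \<Rightarrow> real) set" where
  "L2_space M = {f \<in> borel_measurable M. integrable M (\<lambda>x. (f x)\<^sup>2)}"

definition L2_inner :: "'a measure \<Rightarrow> ('a \<Rightarrow> real) \<Rightarrow> ('a \<Rightarrow> real) \<Rightarrow> real" where
  "L2_inner M f g = (\<integral>x. f x * g x \<partial>M)"

definition L2_norm :: "'a measure \<Rightarrow> ('a \<Rightarrow> real) \<Rightarrow> real" where
  "L2_norm M f = sqrt (L2_inner M f f)"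

text \<open>
  The dimension is the supremum of the lengths of linearly independent families in \<open>S\<close>,
  hence \<open>\<infinity>\<close> in the infinite-dimensional case.
\<close>

definition L2_independent :: "'a measure \<Rightarrow> nat \<Rightarrow> (nat \<Rightarrow> 'a \<Rightarrow> real) \<Rightarrow> bool" where
  "L2_independent M n g \<longleftrightarrow>
     (\<forall>c :: nat \<Rightarrow> real. (AE x in M. (\<Sum>i<n. c i * g i x) = 0) \<longrightarrow> (\<forall>i<n. c i = 0))"

definition L2_dim :: "'a measure \<Rightarrow> ('a \<Rightarrow> real) set \<Rightarrow> enat" where
  "L2_dim M S = (SUP n \<in> {n. \<exists>g. (\<forall>i<n. g i \<in> S) \<and> L2_independent M n g}. enat n)"

definition L2_dense :: "'a measure \<Rightarrow> ('a \<Rightarrow> real) set \<Rightarrow> bool" where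
  "L2_dense M D \<longleftrightarrow> (\<forall>f \<in> L2_space M. \<forall>e>0. \<exists>g \<in> D. L2_norm M (\<lambda>x. f x - g x) < e)"


section \<open>Unbounded operators and spectral decompositions\<close>

text \<open>
  An unbounded operator is given by its graph. Adjoints, and hence self-adjoint operators, are
  automatically saturated under almost-everywhere equality in both components, and density of the
  domain makes the adjoint single-valued up to almost-everywhere equality.
\<close>

type_synonym 'a L2_operator = "(('a \<Rightarrow> real) \<times> ('a \<Rightarrow> real)) set"

definition L2_adjoint :: "'a measure \<Rightarrow> 'a L2_operator \<Rightarrow> 'a L2_operator" where
  "L2_adjoint M A =
     {(g, h). g \<in> L2_space M \<and> h \<in> L2_space M \<and>
              (\<forall>(f, u) \<in> A. L2_inner M u g = L2_inner M f h)}"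

definition L2_self_adjoint :: "'a measure \<Rightarrow> 'a L2_operator \<Rightarrow> bool" where
  "L2_self_adjoint M A \<longleftrightarrow> L2_dense M (Domain A) \<and> L2_adjoint M A = A"

definition L2_orthogonal_projection ::
    "'a measure \<Rightarrow> (('a \<Rightarrow> real) \<Rightarrow> ('a \<Rightarrow> real)) \<Rightarrow> bool" where
  "L2_orthogonal_projection M P \<longleftrightarrow>
     (\<forall>f \<in> L2_space M. P f \<in> L2_space M) \<and>
     (\<forall>f \<in> L2_space M. \<forall>g \<in> L2_space M. \<forall>a b.
        AE x in M. P (\<lambda>y. a * f y + b * g y) x = a * P f x + b * P g x) \<and>
     (\<forall>f \<in> L2_space M. AE x in M. P (P f) x = P f x) \<and>
     (\<forall>f \<in> L2_space M. \<forall>g \<in> L2_space M. L2_inner M (P f) g = L2_inner M f (P g))"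

text \<open>
  Right-continuity in the strong operator topology encodes that \<open>E t\<close> is the spectral
  projection onto the closed half-line \<open>{..t}\<close>.
\<close>

definition resolution_of_identity ::
    "'a measure \<Rightarrow> (real \<Rightarrow> ('a \<Rightarrow> real) \<Rightarrow> ('a \<Rightarrow> real)) \<Rightarrow> bool" where
  "resolution_of_identity M E \<longleftrightarrow>
     (\<forall>t. L2_orthogonal_projection M (E t)) \<and>
     (\<forall>s t. \<forall>f \<in> L2_space M. AE x in M. E s (E t f) x = E (min s t) f x) \<and>
     (\<forall>t. \<forall>f \<in> L2_space M. ((\<lambda>s. L2_norm M (\<lambda>x. E s f x - E t f x)) \<longlongrightarrow> 0) (at_right t)) \<and>
     (\<forall>f \<in> L2_space M. ((\<lambda>s. L2_norm M (E s f)) \<longlongrightarrow> 0) at_bot) \<and>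
     (\<forall>f \<in> L2_space M. ((\<lambda>s. L2_norm M (\<lambda>x. E s f x - f x)) \<longlongrightarrow> 0) at_top)"

text \<open>
  For a resolution of the identity \<open>E\<close>, the function \<open>t \<mapsto> \<langle>f, E t f\<rangle>\<close> is non-decreasing and
  right-continuous; this is its Lebesgue--Stieltjes measure.
\<close>

definition spectral_measure ::
    "'a measure \<Rightarrow> (real \<Rightarrow> ('a \<Rightarrow> real) \<Rightarrow> ('a \<Rightarrow> real)) \<Rightarrow> ('a \<Rightarrow> real) \<Rightarrow> real measure" where
  "spectral_measure M E f = interval_measure (\<lambda>t. L2_inner M f (E t f))"

text \<open>
  \<open>A = \<integral> t dE(t)\<close>: the domain of \<open>A\<close> consists of the \<open>f\<close> with
  \<open>\<integral> t\<^sup>2 d\<langle>f, E(t) f\<rangle> < \<infinity>\<close>, and \<open>\<langle>f, A f\<rangle> = \<integral> t d\<langle>f, E(t) f\<rangle>\<close> on the domain. As \<open>A\<close> is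
  symmetric, the quadratic form determines \<open>A\<close> by polarization.
\<close>

definition spectral_decomposition ::
    "'a measure \<Rightarrow> 'a L2_operator \<Rightarrow> (real \<Rightarrow> ('a \<Rightarrow> real) \<Rightarrow> ('a \<Rightarrow> real)) \<Rightarrow> bool" where
  "spectral_decomposition M A E \<longleftrightarrow>
     L2_self_adjoint M A \<and>
     resolution_of_identity M E \<and>
     Domain A = {f \<in> L2_space M. integrable (spectral_measure M E f) (\<lambda>t. t\<^sup>2)} \<and>
     (\<forall>(f, u) \<in> A. L2_inner M f u = (\<integral>t. t \<partial>spectral_measure M E f))"

definition spectral_lambda ::
    "'a measure \<Rightarrow> (real \<Rightarrow> ('a \<Rightarrow> real) \<Rightarrow> ('a \<Rightarrow> real)) \<Rightarrow> nat \<Rightarrow> ereal" where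
  "spectral_lambda M E k = (SUP t \<in> {t. L2_dim M (E t ` L2_space M) < enat k}. ereal t)"


section \<open>Weighted Laplacians on the real line\<close>

definition smooth_real :: "(real \<Rightarrow> real) \<Rightarrow> bool" where
  "smooth_real f \<longleftrightarrow> (\<forall>n x. ((deriv ^^ n) f) field_differentiable (at x))"

definition test_functions :: "(real \<Rightarrow> real) set" where
  "test_functions = {f. smooth_real f \<and> compact (closure {x. f x \<noteq> 0})}"

definition smooth_positive_density :: "real measure \<Rightarrow> (real \<Rightarrow> real) \<Rightarrow> bool" where
  "smooth_positive_density \<mu> f \<longleftrightarrow>
     smooth_real f \<and> (\<forall>x. 0 < f x) \<and> \<mu> = density lborel (\<lambda>x. ennreal (f x))"

text \<open>\<open>V\<close> is the potential of the measure \<open>exp(-V(x)) dx\<close>.\<close>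

definition weighted_laplacian :: "(real \<Rightarrow> real) \<Rightarrow> (real \<Rightarrow> real) \<Rightarrow> real \<Rightarrow> real" where
  "weighted_laplacian V f x = deriv (deriv f) x - deriv V x * deriv f x"

definition neg_laplacian_graph :: "(real \<Rightarrow> real) \<Rightarrow> real L2_operator" where
  "neg_laplacian_graph V = {(f, \<lambda>x. - weighted_laplacian V f x) | f. f \<in> test_functions}"

text \<open>
  \<open>A\<close> is a self-adjoint extension of \<open>-\<Delta>\<^sub>\<mu>\<close> on \<open>C\<^sub>c\<^sup>\<infinity>(\<real>)\<close>, where \<open>\<mu>\<close> has density \<open>f\<close>, so that
  \<open>V = -ln f\<close>. By essential self-adjointness it is unique.
\<close>

definition self_adjoint_laplacian ::
    "real measure \<Rightarrow> (real \<Rightarrow> real) \<Rightarrow> real L2_operator \<Rightarrow> bool" where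
  "self_adjoint_laplacian \<mu> f A \<longleftrightarrow>
     L2_self_adjoint \<mu> A \<and> neg_laplacian_graph (\<lambda>x. - ln (f x)) \<subseteq> A"

definition flat_profile :: "real measure \<Rightarrow> (real \<Rightarrow> real) \<Rightarrow> real \<Rightarrow> real" where
  "flat_profile \<mu> f v = (if 0 < v \<and> v < 1 then f (inv (cdf \<mu>) v) else 0)"

end

theory Submission
  imports Defs
begin

text \<open>
  The increasing map \<open>T\<close> pushing \<open>\<mu>1\<close> forward to \<open>\<mu>2\<close> has derivative \<open>f1 / (f2 \<circ> T)\<close>, which at the quantile \<open>v\<close>
  is the ratio of the flat profiles at \<open>v\<close>; so \<open>T\<close> is \<open>L\<close>-Lipschitz, and \<open>v \<mapsto> v \<circ> T\<close> preserves \<open>L\<^sup>2\<close>-norms and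
  increases Dirichlet energies at most by the factor \<open>L\<^sup>2\<close>. The eigenvalues are then compared by a min-max
  argument. Only two facts link the operators to their Dirichlet forms, and both follow from the observation that
  an element of the domain of a self-adjoint extension is a weak solution of an ordinary differential equation,
  hence \<open>C\<^sup>1\<close>: energy is at most \<open>s\<close> times the norm squared on the range of \<open>E s\<close>, and at least \<open>t\<close> times the norm
  squared for any \<open>C\<^sup>1\<close> function of finite energy orthogonal to the range of \<open>E t\<close>.
\<close>

section \<open>Square-integrable functions\<close>

text \<open>The pullback of a function along \<open>T\<close> is only known to be C^1 with finite
  energy: the hypothesis bounds the first derivative of \<open>T\<close> and says nothing about the
  second. Hence the lower bound for the Rayleigh quotient must hold for such functions
  \<open>w\<close> and not just on the domain of \<open>A1\<close>. No density of a core in a form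
  domain enters: the truncation \<open>E b w\<close> does lie in the domain, and \<open>w\<close>
  itself occurs only as a test function in Green's formula for it. The spectrum need not be
  discrete, so levels are compared instead of eigenfunctions. Suppose the range of
  \<open>E1 t\<close> has dimension below \<open>k\<close> and \<open>s < t / L^2\<close>. Among
  \<open>k\<close> independent elements of the range of \<open>E2 s\<close>, some nontrivial
  combination has a pullback annihilated by \<open>E1 t\<close>. The energy of that pullback is at
  least \<open>t\<close> and at most \<open>L^2 * s\<close> times its squared norm, which forces the
  combination to vanish.\<close>

lemma L2_measurable [measurable_dest]: "f \<in> L2_space M \<Longrightarrow> f \<in> borel_measurable M"
  by (simp add: L2_space_def)

lemma L2_integrable_square: "f \<in> L2_space M \<Longrightarrow> integrable M (\<lambda>x. (f x)\<^sup>2)"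
  by (simp add: L2_space_def)

lemma L2_integrable_mult:
  assumes "f \<in> L2_space M" "g \<in> L2_space M"
  shows "integrable M (\<lambda>x. f x * g x)"
proof (rule Bochner_Integration.integrable_bound)
  show "integrable M (\<lambda>x. (f x)\<^sup>2 + (g x)\<^sup>2)"
    using assms by (simp add: L2_space_def)
  have [measurable]: "f \<in> borel_measurable M" "g \<in> borel_measurable M"
    using assms by (simp_all add: L2_space_def)
  show "(\<lambda>x. f x * g x) \<in> borel_measurable M"
    by measurable
  have "\<bar>a * b\<bar> \<le> a\<^sup>2 + b\<^sup>2" for a b :: real
  proof -
    have "2 * \<bar>a\<bar> * \<bar>b\<bar> \<le> a\<^sup>2 + b\<^sup>2"
      using sum_squares_bound[of "\<bar>a\<bar>" "\<bar>b\<bar>"] by simp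
    moreover have "0 \<le> \<bar>a\<bar> * \<bar>b\<bar>" by simp
    ultimately have "\<bar>a\<bar> * \<bar>b\<bar> \<le> a\<^sup>2 + b\<^sup>2" by linarith
    then show ?thesis by (simp add: abs_mult)
  qed
  then show "AE x in M. norm (f x * g x) \<le> norm ((f x)\<^sup>2 + (g x)\<^sup>2)"
    by simp
qed

lemma L2_lincomb:
  assumes "f \<in> L2_space M" "g \<in> L2_space M"
  shows "(\<lambda>x. a * f x + b * g x) \<in> L2_space M"
proof -
  have "integrable M (\<lambda>x. a\<^sup>2 * (f x)\<^sup>2 + 2 * a * b * (f x * g x) + b\<^sup>2 * (g x)\<^sup>2)"
    using L2_integrable_mult[OF assms] assms by (simp add: L2_space_def)
  also have "(\<lambda>x. a\<^sup>2 * (f x)\<^sup>2 + 2 * a * b * (f x * g x) + b\<^sup>2 * (g x)\<^sup>2)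
      = (\<lambda>x. (a * f x + b * g x)\<^sup>2)"
    by (simp add: power2_eq_square algebra_simps)
  finally have "integrable M (\<lambda>x. (a * f x + b * g x)\<^sup>2)" .
  moreover have [measurable]: "f \<in> borel_measurable M" "g \<in> borel_measurable M"
    using assms by (simp_all add: L2_space_def)
  ultimately show ?thesis
    by (simp add: L2_space_def)
qed

lemma L2_diff: "f \<in> L2_space M \<Longrightarrow> g \<in> L2_space M \<Longrightarrow> (\<lambda>x. f x - g x) \<in> L2_space M"
  using L2_lincomb[of f M g 1 "-1"] by simp

lemma L2_zero: "(\<lambda>_. 0) \<in> L2_space M"
  by (simp add: L2_space_def)

lemma L2_sum:
  fixes n :: nat
  assumes "\<And>i. i < n \<Longrightarrow> g i \<in> L2_space M"
  shows "(\<lambda>x. \<Sum>i<n. c i * g i x) \<in> L2_space M"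
  using assms
proof (induction n)
  case (Suc n)
  then show ?case
    using L2_lincomb[of "\<lambda>x. \<Sum>i<n. c i * g i x" M "g n" 1 "c n"] by simp
qed (simp add: L2_zero)

lemma L2_cong_AE:
  assumes "f \<in> L2_space M" "g \<in> borel_measurable M" "AE x in M. f x = g x"
  shows "g \<in> L2_space M"
proof -
  have "integrable M (\<lambda>x. (g x)\<^sup>2)"
    using assms by (subst integrable_cong_AE[of _ _ "\<lambda>x. (f x)\<^sup>2"]) (auto simp: L2_space_def)
  with assms show ?thesis by (simp add: L2_space_def)
qed

lemma L2_inner_commute: "L2_inner M f g = L2_inner M g f"
  by (simp add: L2_inner_def mult.commute)

lemma L2_inner_lincomb_left:
  assumes "f \<in> L2_space M" "g \<in> L2_space M" "h \<in> L2_space M"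
  shows "L2_inner M (\<lambda>x. a * f x + b * g x) h = a * L2_inner M f h + b * L2_inner M g h"
proof -
  have "L2_inner M (\<lambda>x. a * f x + b * g x) h = (\<integral>x. a * (f x * h x) + b * (g x * h x) \<partial>M)"
    by (simp add: L2_inner_def algebra_simps)
  then show ?thesis
    using assms by (simp add: L2_inner_def L2_integrable_mult)
qed

lemma L2_inner_diff_left:
  assumes "f \<in> L2_space M" "g \<in> L2_space M" "h \<in> L2_space M"
  shows "L2_inner M (\<lambda>x. f x - g x) h = L2_inner M f h - L2_inner M g h"
  using L2_inner_lincomb_left[OF assms, of 1 "-1"] by simp

lemma L2_inner_diff_right:
  assumes "f \<in> L2_space M" "g \<in> L2_space M" "h \<in> L2_space M"
  shows "L2_inner M h (\<lambda>x. f x - g x) = L2_inner M h f - L2_inner M h g"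
  using L2_inner_diff_left[OF assms] by (simp add: L2_inner_commute)

lemma L2_inner_cong_AE:
  assumes "f \<in> borel_measurable M" "f' \<in> borel_measurable M"
    and "g \<in> borel_measurable M" "g' \<in> borel_measurable M"
    and "AE x in M. f x = f' x" "AE x in M. g x = g' x"
  shows "L2_inner M f g = L2_inner M f' g'"
  unfolding L2_inner_def using assms by (intro integral_cong_AE) auto

lemma L2_inner_self_nonneg: "0 \<le> L2_inner M f f"
  by (simp add: L2_inner_def)

lemma L2_inner_self_eq_0_iff:
  assumes "f \<in> L2_space M"
  shows "L2_inner M f f = 0 \<longleftrightarrow> (AE x in M. f x = 0)"
  using integral_nonneg_eq_0_iff_AE[OF L2_integrable_square[OF assms]]
  by (simp add: L2_inner_def power2_eq_square)

lemma L2_norm_square: "(L2_norm M f)\<^sup>2 = L2_inner M f f"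
  by (simp add: L2_norm_def L2_inner_self_nonneg)

lemma L2_Cauchy_Schwarz:
  assumes "f \<in> L2_space M" "g \<in> L2_space M"
  shows "(L2_inner M f g)\<^sup>2 \<le> L2_inner M f f * L2_inner M g g"
proof (cases "L2_inner M g g = 0")
  case True
  then have "AE x in M. g x = 0"
    using assms by (simp add: L2_inner_self_eq_0_iff)
  then have "L2_inner M f g = L2_inner M f (\<lambda>_. 0)"
    using assms by (intro L2_inner_cong_AE) (auto simp: L2_space_def)
  then show ?thesis using True by (simp add: L2_inner_def)
next
  case False
  define b where "b = L2_inner M f g"
  define c where "c = L2_inner M g g"
  have c: "c > 0" using False L2_inner_self_nonneg[of M g] by (simp add: c_def)
  let ?h = "\<lambda>x. c * f x + (- b) * g x"
  have h: "?h \<in> L2_space M" using assms by (rule L2_lincomb)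
  have "L2_inner M ?h ?h = c * L2_inner M f ?h + (- b) * L2_inner M g ?h"
    by (rule L2_inner_lincomb_left[OF assms h])
  also have "L2_inner M f ?h = c * L2_inner M f f + (- b) * b"
    unfolding b_def using assms L2_inner_lincomb_left[OF assms assms(1), of c "- b"]
    by (simp add: L2_inner_commute b_def)
  also have "L2_inner M g ?h = c * b + (- b) * c"
    using assms L2_inner_lincomb_left[OF assms assms(2), of c "- b"]
    by (simp add: L2_inner_commute b_def c_def)
  finally have "0 \<le> c * (c * L2_inner M f f - b\<^sup>2)"
    using L2_inner_self_nonneg[of M ?h] by (simp add: power2_eq_square algebra_simps)
  then have "b\<^sup>2 \<le> L2_inner M f f * c"
    using c by (simp add: zero_le_mult_iff mult.commute)
  then show ?thesis by (simp add: b_def c_def)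
qed

lemma L2_inner_le_norm:
  assumes "f \<in> L2_space M" "g \<in> L2_space M"
  shows "\<bar>L2_inner M f g\<bar> \<le> L2_norm M f * L2_norm M g"
proof (rule power2_le_imp_le)
  show "\<bar>L2_inner M f g\<bar>\<^sup>2 \<le> (L2_norm M f * L2_norm M g)\<^sup>2"
    using L2_Cauchy_Schwarz[OF assms] by (simp add: power_mult_distrib L2_norm_square)
  show "0 \<le> L2_norm M f * L2_norm M g"
    by (simp add: L2_norm_def L2_inner_self_nonneg)
qed

text \<open>Strong convergence implies weak convergence. The axioms on \<open>E\<close> are limits
  in norm, while spectral measures are built from inner products.\<close>

lemma L2_inner_tendsto:
  assumes "f \<in> L2_space M" "g \<in> L2_space M" "\<And>s. G s \<in> L2_space M"
    and "((\<lambda>s. L2_norm M (\<lambda>x. G s x - g x)) \<longlongrightarrow> 0) F"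
  shows "((\<lambda>s. L2_inner M f (G s)) \<longlongrightarrow> L2_inner M f g) F"
proof (rule LIM_zero_cancel, rule Lim_null_comparison)
  show "\<forall>\<^sub>F s in F. norm (L2_inner M f (G s) - L2_inner M f g) \<le> L2_norm M f * L2_norm M (\<lambda>x. G s x - g x)"
    using L2_inner_le_norm[OF assms(1) L2_diff[OF assms(3,2)]] L2_inner_diff_right[OF assms(3,2,1)]
    by simp
  show "((\<lambda>s. L2_norm M f * L2_norm M (\<lambda>x. G s x - g x)) \<longlongrightarrow> 0) F"
    using assms(4) by (rule tendsto_mult_right_zero)
qed


section \<open>Spectral calculus\<close>

text \<open>The restriction of \<open>N\<close> to \<open>B\<close>, written as a density so that
  the rules for densities apply to it. Comparing cdfs will identify spectral measures of projected
  vectors with such restrictions.\<close>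

lemma cdf_density_indicator:
  assumes "finite_borel_measure N" "B \<in> sets borel"
  shows "finite_borel_measure (density N (indicator B))"
    and "cdf (density N (indicator B)) t = measure N (B \<inter> {..t})"
proof -
  interpret finite_borel_measure N by fact
  have B: "B \<in> sets N" using assms(2) M_is_borel by simp
  have e: "emeasure (density N (indicator B)) X = emeasure N (B \<inter> X)" if "X \<in> sets N" for X
    using that B by (subst emeasure_density) (auto simp: indicator_inter_arith[symmetric])
  show "finite_borel_measure (density N (indicator B))"
  proof (intro finite_borel_measure.intro finite_measureI finite_borel_measure_axioms.intro)
    show "emeasure (density N (indicator B)) (space (density N (indicator B))) \<noteq> \<infinity>"
      using e[of "space N"] by simp
    show "sets (density N (indicator B)) = sets borel"
      using M_is_borel by simp
  qed
  show "cdf (density N (indicator B)) t = measure N (B \<inter> {..t})"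
    unfolding cdf_def measure_def using e[of "{..t}"] M_is_borel by simp
qed

section \<open>Resolutions of the identity and their spectral measures\<close>

locale spectral_resolution =
  fixes M :: "'a measure" and E :: "real \<Rightarrow> ('a \<Rightarrow> real) \<Rightarrow> ('a \<Rightarrow> real)"
  assumes resolution: "resolution_of_identity M E"
begin

lemma E_L2 [simp]: "f \<in> L2_space M \<Longrightarrow> E t f \<in> L2_space M"
  using resolution by (simp add: resolution_of_identity_def L2_orthogonal_projection_def)

lemma E_lincomb:
  "f \<in> L2_space M \<Longrightarrow> g \<in> L2_space M \<Longrightarrow>
    AE x in M. E t (\<lambda>y. a * f y + b * g y) x = a * E t f x + b * E t g x"
  using resolution by (simp add: resolution_of_identity_def L2_orthogonal_projection_def)

lemma E_diff:
  "f \<in> L2_space M \<Longrightarrow> g \<in> L2_space M \<Longrightarrow> AE x in M. E t (\<lambda>y. f y - g y) x = E t f x - E t g x"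
  using E_lincomb[of f g t 1 "-1"] by simp

lemma E_symmetric:
  "f \<in> L2_space M \<Longrightarrow> g \<in> L2_space M \<Longrightarrow> L2_inner M (E t f) g = L2_inner M f (E t g)"
  using resolution by (simp add: resolution_of_identity_def L2_orthogonal_projection_def)

lemma E_E: "f \<in> L2_space M \<Longrightarrow> AE x in M. E s (E t f) x = E (min s t) f x"
  using resolution by (simp add: resolution_of_identity_def)

lemma E_right_limit:
  "f \<in> L2_space M \<Longrightarrow> ((\<lambda>s. L2_norm M (\<lambda>x. E s f x - E t f x)) \<longlongrightarrow> 0) (at_right t)"
  using resolution by (simp add: resolution_of_identity_def)

lemma E_at_bot: "f \<in> L2_space M \<Longrightarrow> ((\<lambda>s. L2_norm M (E s f)) \<longlongrightarrow> 0) at_bot"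
  using resolution by (simp add: resolution_of_identity_def)

lemma E_at_top: "f \<in> L2_space M \<Longrightarrow> ((\<lambda>s. L2_norm M (\<lambda>x. E s f x - f x)) \<longlongrightarrow> 0) at_top"
  using resolution by (simp add: resolution_of_identity_def)

lemma inner_E_E:
  assumes "f \<in> L2_space M" "g \<in> L2_space M"
  shows "L2_inner M (E s f) (E t g) = L2_inner M f (E (min s t) g)"
proof -
  have "L2_inner M (E s f) (E t g) = L2_inner M f (E s (E t g))"
    using assms by (simp add: E_symmetric)
  also have "\<dots> = L2_inner M f (E (min s t) g)"
    using assms E_E[of g s t] by (intro L2_inner_cong_AE) (auto intro: L2_measurable)
  finally show ?thesis .
qed

text \<open>\<open>E t\<close> acts on functions, so its compatibility with a.e. equality has to be
  derived. For \<open>h\<close> vanishing a.e., idempotence and symmetry turn the squared norm of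
  \<open>E t h\<close> into the inner product of \<open>h\<close> and \<open>E t h\<close>, which is
  0.\<close>

lemma E_cong_AE:
  assumes f: "f \<in> L2_space M" and g: "g \<in> L2_space M" and eq: "AE x in M. f x = g x"
  shows "AE x in M. E t f x = E t g x"
proof -
  let ?h = "\<lambda>x. f x - g x"
  have h: "?h \<in> L2_space M" using f g by (rule L2_diff)
  have "L2_inner M (E t ?h) (E t ?h) = L2_inner M ?h (E t ?h)"
    using inner_E_E[OF h h, of t t] by simp
  also have "\<dots> = L2_inner M (\<lambda>_. 0) (E t ?h)"
    using eq h f g by (intro L2_inner_cong_AE) (auto intro: L2_measurable)
  finally have "AE x in M. E t ?h x = 0"
    using L2_inner_self_eq_0_iff[OF E_L2[OF h]] by (simp add: L2_inner_def)
  then show ?thesis using E_diff[OF f g, of t] by eventually_elim simp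
qed

lemma E_sum:
  fixes n :: nat
  assumes "\<And>i. i < n \<Longrightarrow> g i \<in> L2_space M"
  shows "AE x in M. E t (\<lambda>y. \<Sum>i<n. c i * g i y) x = (\<Sum>i<n. c i * E t (g i) x)"
  using assms
proof (induction n)
  case 0
  \<comment> \<open>Linearity with zero coefficients yields \<open>E t 0 = 0\<close>.\<close>
  have "AE x in M. E t (\<lambda>y. 0 * 0 + 0 * 0) x = 0 * E t (\<lambda>_. 0) x + 0 * E t (\<lambda>_. 0) x"
    by (rule E_lincomb) (rule L2_zero)+
  then show ?case by simp
next
  case (Suc n)
  have "AE x in M. E t (\<lambda>y. 1 * (\<Sum>i<n. c i * g i y) + c n * g n y) x =
      1 * E t (\<lambda>y. \<Sum>i<n. c i * g i y) x + c n * E t (g n) x"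
    using Suc.prems by (intro E_lincomb L2_sum) auto
  moreover have "AE x in M. E t (\<lambda>y. \<Sum>i<n. c i * g i y) x = (\<Sum>i<n. c i * E t (g i) x)"
    using Suc by simp
  ultimately show ?case by eventually_elim simp
qed

definition distribution :: "('a \<Rightarrow> real) \<Rightarrow> real \<Rightarrow> real" where
  "distribution f t = L2_inner M f (E t f)"

lemma distribution_eq: "f \<in> L2_space M \<Longrightarrow> distribution f t = L2_inner M (E t f) (E t f)"
  by (simp add: distribution_def inner_E_E)

text \<open>For \<open>s \<le> t\<close> the inner product of \<open>E s f\<close> and
  \<open>E t f\<close> is already the squared norm of \<open>E s f\<close>, so Cauchy-Schwarz gives
  the claim after cancelling one factor.\<close>

lemma distribution_mono:
  assumes f: "f \<in> L2_space M" and "s \<le> t"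
  shows "distribution f s \<le> distribution f t"
proof -
  have "distribution f s = L2_inner M (E s f) (E t f)"
    using inner_E_E[OF f f, of s t] \<open>s \<le> t\<close> by (simp add: distribution_def min_absorb1)
  then have "(distribution f s)\<^sup>2 \<le> distribution f s * distribution f t"
    using L2_Cauchy_Schwarz[OF E_L2[OF f] E_L2[OF f], of s t] f by (simp add: distribution_eq)
  then show ?thesis
    using L2_inner_self_nonneg[of M "E s f"] L2_inner_self_nonneg[of M "E t f"] f
    by (cases "distribution f s = 0") (auto simp: distribution_eq power2_eq_square)
qed

lemma distribution_right_continuous:
  "f \<in> L2_space M \<Longrightarrow> continuous (at_right t) (distribution f)"
  unfolding continuous_within distribution_def
  by (intro L2_inner_tendsto E_right_limit) auto

lemma distribution_at_bot: "f \<in> L2_space M \<Longrightarrow> (distribution f \<longlongrightarrow> 0) at_bot"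
  using L2_inner_tendsto[of f M "\<lambda>_. 0" "\<lambda>s. E s f" at_bot] E_at_bot[of f] L2_zero[of M]
  by (simp add: distribution_def[abs_def] L2_inner_def)

lemma distribution_at_top: "f \<in> L2_space M \<Longrightarrow> (distribution f \<longlongrightarrow> L2_inner M f f) at_top"
  unfolding distribution_def by (intro L2_inner_tendsto E_at_top) auto

lemma spectral_measure_eq: "spectral_measure M E f = interval_measure (distribution f)"
  by (simp add: spectral_measure_def distribution_def[abs_def])

lemma finite_spectral_measure: "f \<in> L2_space M \<Longrightarrow> finite_borel_measure (spectral_measure M E f)"
  unfolding spectral_measure_eq
  by (rule finite_borel_measure_interval_measure[OF distribution_mono distribution_right_continuous
        distribution_at_bot distribution_at_top L2_inner_self_nonneg])

lemma cdf_spectral_measure: "f \<in> L2_space M \<Longrightarrow> cdf (spectral_measure M E f) = distribution f"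
  unfolding spectral_measure_eq
  by (rule cdf_interval_measure[OF distribution_mono distribution_right_continuous distribution_at_bot])

lemma spectral_measure_UNIV:
  assumes "f \<in> L2_space M"
  shows "measure (spectral_measure M E f) UNIV = L2_inner M f f"
proof -
  have "emeasure (spectral_measure M E f) UNIV = L2_inner M f f"
    unfolding spectral_measure_eq
    by (rule interval_measure_UNIV[OF distribution_mono[OF assms] distribution_right_continuous[OF assms]
        distribution_at_bot[OF assms] distribution_at_top[OF assms] L2_inner_self_nonneg])
  then show ?thesis by (simp add: measure_def L2_inner_self_nonneg)
qed

lemma spectral_measure_cong_AE:
  assumes "f \<in> L2_space M" "g \<in> L2_space M" "AE x in M. f x = g x"
  shows "spectral_measure M E f = spectral_measure M E g"
proof -
  have "distribution f t = distribution g t" for t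
    unfolding distribution_def using assms E_cong_AE[OF assms]
    by (intro L2_inner_cong_AE) (auto intro: L2_measurable)
  then have "distribution f = distribution g" by (rule ext)
  then show ?thesis by (simp add: spectral_measure_eq)
qed

text \<open>The distribution function of \<open>E b f\<close> at \<open>t\<close> is that of
  \<open>f\<close> at \<open>min b t\<close>: it follows the one of \<open>f\<close> up to
  \<open>b\<close> and is constant afterwards.\<close>

lemma spectral_measure_E:
  assumes f: "f \<in> L2_space M"
  shows "spectral_measure M E (E b f) = density (spectral_measure M E f) (indicator {..b})"
proof (rule cdf_unique')
  note N = finite_spectral_measure[OF f]
  show "finite_borel_measure (spectral_measure M E (E b f))"
    using f by (simp add: finite_spectral_measure)
  show "finite_borel_measure (density (spectral_measure M E f) (indicator {..b}))"
    by (rule cdf_density_indicator[OF N]) simp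
  show "cdf (spectral_measure M E (E b f)) = cdf (density (spectral_measure M E f) (indicator {..b}))"
  proof
    fix t
    have "distribution (E b f) t = L2_inner M (E b f) (E (min t b) f)"
      unfolding distribution_def using f E_E[OF f, of t b]
      by (intro L2_inner_cong_AE) (auto intro: L2_measurable)
    also have "\<dots> = distribution f (min b t)"
      using f by (simp add: inner_E_E distribution_def) (simp add: min.commute)
    also have "\<dots> = measure (spectral_measure M E f) {..min b t}"
      using cdf_spectral_measure[OF f] by (simp add: cdf_def fun_eq_iff)
    also have "{..min b t} = {..b} \<inter> {..t}" by auto
    finally show "cdf (spectral_measure M E (E b f)) t = cdf (density (spectral_measure M E f) (indicator {..b})) t"
      using f by (simp add: cdf_density_indicator(2)[OF N] cdf_spectral_measure)
  qed
qed

text \<open>Complementary to the previous case: \<open>E t (f - E b f)\<close> is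
  \<open>E t f - E (min t b) f\<close>, whose squared norm is the increment of the distribution
  function from \<open>min t b\<close> to \<open>t\<close>.\<close>

lemma spectral_measure_diff_E:
  assumes f: "f \<in> L2_space M"
  shows "spectral_measure M E (\<lambda>x. f x - E b f x) = density (spectral_measure M E f) (indicator {b<..})"
proof (rule cdf_unique')
  let ?g = "\<lambda>x. f x - E b f x"
  note N = finite_spectral_measure[OF f]
  interpret N: finite_borel_measure "spectral_measure M E f" by (rule N)
  have g: "?g \<in> L2_space M" using f by (simp add: L2_diff)
  show "finite_borel_measure (spectral_measure M E ?g)"
    using g by (simp add: finite_spectral_measure)
  show "finite_borel_measure (density (spectral_measure M E f) (indicator {b<..}))"
    by (rule cdf_density_indicator[OF N]) simp
  show "cdf (spectral_measure M E ?g) = cdf (density (spectral_measure M E f) (indicator {b<..}))"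
  proof
    fix t
    have "distribution ?g t = L2_inner M (E t ?g) (E t ?g)"
      using g by (simp add: distribution_eq)
    also have "\<dots> = L2_inner M (\<lambda>x. E t f x - E (min t b) f x) (\<lambda>x. E t f x - E (min t b) f x)"
    proof -
      have "AE x in M. E t ?g x = E t f x - E (min t b) f x"
        using E_diff[OF f E_L2[OF f], of t b] E_E[OF f, of t b] by eventually_elim simp
      then show ?thesis
        using f g by (intro L2_inner_cong_AE) (auto intro!: L2_measurable L2_diff)
    qed
    also have "\<dots> = distribution f t - distribution f (min t b)"
      using f by (simp add: L2_inner_diff_left L2_inner_diff_right L2_diff inner_E_E distribution_def)
    also have "\<dots> = measure (spectral_measure M E f) ({b<..} \<inter> {..t})"
    proof (cases "b < t")
      case True
      then have "{b<..} \<inter> {..t} = {b<..t}" "min t b = b" by auto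
      then show ?thesis
        using N.cdf_diff_eq[OF True] cdf_spectral_measure[OF f] by simp
    next
      case False
      then have "{b<..} \<inter> {..t} = {}" "min t b = t" by auto
      then show ?thesis by simp
    qed
    finally show "cdf (spectral_measure M E ?g) t = cdf (density (spectral_measure M E f) (indicator {b<..})) t"
      using g by (simp add: cdf_density_indicator(2)[OF N] cdf_spectral_measure)
  qed
qed

lemma AE_spectral_measure_E:
  assumes "f \<in> L2_space M"
  shows "AE t in spectral_measure M E (E b f). t \<le> b"
  unfolding spectral_measure_E[OF assms]
  by (subst AE_density) (auto simp: spectral_measure_eq indicator_def)

text \<open>Here \<open>f\<close> agrees a.e. with \<open>f - E a f\<close>, so its spectral measure
  coincides with its own restriction to \<open>{a<..}\<close>.\<close>

lemma AE_spectral_measure_lower: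
  assumes "f \<in> L2_space M" "AE x in M. E a f x = 0"
  shows "AE t in spectral_measure M E f. a < t"
proof -
  have "spectral_measure M E f = spectral_measure M E (\<lambda>x. f x - E a f x)"
    using assms by (intro spectral_measure_cong_AE) (auto simp: L2_diff)
  also have "\<dots> = density (spectral_measure M E f) (indicator {a<..})"
    by (rule spectral_measure_diff_E[OF assms(1)])
  finally have eq: "spectral_measure M E f = density (spectral_measure M E f) (indicator {a<..})" .
  have "AE t in density (spectral_measure M E f) (indicator {a<..}). a < t"
    by (subst AE_density) (auto simp: spectral_measure_eq indicator_def)
  then show ?thesis by (simp only: eq[symmetric])
qed

end

section \<open>Domain and quadratic form of an operator with a spectral decomposition\<close>

locale spectral_operator =
  fixes M :: "'a measure" and A :: "'a L2_operator" and E :: "real \<Rightarrow> ('a \<Rightarrow> real) \<Rightarrow> ('a \<Rightarrow> real)"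
  assumes decomposition: "spectral_decomposition M A E"

sublocale spectral_operator \<subseteq> spectral_resolution M E
  using decomposition by unfold_locales (simp add: spectral_decomposition_def)

context spectral_operator
begin

lemma adjoint_eq: "L2_adjoint M A = A"
  using decomposition by (simp add: spectral_decomposition_def L2_self_adjoint_def)

lemma A_L2: "(f, h) \<in> A \<Longrightarrow> f \<in> L2_space M" "(f, h) \<in> A \<Longrightarrow> h \<in> L2_space M"
  using adjoint_eq by (auto simp: L2_adjoint_def)

lemma A_symmetric: "(f, h) \<in> A \<Longrightarrow> (g, k) \<in> A \<Longrightarrow> L2_inner M h g = L2_inner M f k"
proof -
  assume "(f, h) \<in> A" "(g, k) \<in> A"
  moreover then have "(g, k) \<in> L2_adjoint M A" by (simp only: adjoint_eq)
  ultimately show ?thesis by (auto simp: L2_adjoint_def)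
qed

text \<open>Adjoints are cut out by linear equations, so an operator equal to its adjoint is
  linear.\<close>

lemma A_diff:
  assumes "(f, h) \<in> A" "(g, k) \<in> A"
  shows "(\<lambda>x. f x - g x, \<lambda>x. h x - k x) \<in> A"
proof -
  have "L2_inner M u (\<lambda>x. f x - g x) = L2_inner M v (\<lambda>x. h x - k x)" if "(v, u) \<in> A" for v u
    using that assms A_symmetric[OF that assms(1)] A_symmetric[OF that assms(2)]
    by (simp add: L2_inner_diff_right A_L2)
  then have "(\<lambda>x. f x - g x, \<lambda>x. h x - k x) \<in> L2_adjoint M A"
    using assms by (auto simp: L2_adjoint_def L2_diff A_L2)
  then show ?thesis by (simp add: adjoint_eq)
qed

lemma in_Domain_iff:
  "f \<in> Domain A \<longleftrightarrow> f \<in> L2_space M \<and> integrable (spectral_measure M E f) (\<lambda>t. t\<^sup>2)"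
  using decomposition by (auto simp: spectral_decomposition_def)

lemma A_quadratic_form:
  "(f, u) \<in> A \<Longrightarrow> L2_inner M f u = (\<integral>t. t \<partial>spectral_measure M E f)"
  using decomposition by (auto simp: spectral_decomposition_def)

text \<open>The two a.e. equations confine the spectral measure of \<open>f\<close> to
  \<open>(a, b]\<close>. A finite measure there has a second moment, which puts \<open>f\<close>
  into the domain, and its first moment lies between \<open>a\<close> and \<open>b\<close> times its
  mass, the squared norm of \<open>f\<close>.\<close>

lemma bounded_spectrum:
  assumes f: "f \<in> L2_space M" and low: "AE x in M. E a f x = 0" and high: "AE x in M. E b f x = f x"
  shows "f \<in> Domain A"
    and "(f, h) \<in> A \<Longrightarrow> a * L2_inner M f f \<le> L2_inner M f h"
    and "(f, h) \<in> A \<Longrightarrow> L2_inner M f h \<le> b * L2_inner M f f"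
proof -
  let ?N = "spectral_measure M E f"
  interpret finite_borel_measure ?N by (rule finite_spectral_measure[OF f])
  have sets [measurable_cong, simp]: "sets ?N = sets borel" and space [simp]: "space ?N = UNIV"
    by (simp_all add: spectral_measure_eq)
  have "spectral_measure M E (E b f) = ?N"
    using f high by (intro spectral_measure_cong_AE) auto
  then have up: "AE t in ?N. t \<le> b" using AE_spectral_measure_E[OF f, of b] by (simp only:)
  have lo: "AE t in ?N. a < t" by (rule AE_spectral_measure_lower[OF f low])
  have mass: "measure ?N UNIV = L2_inner M f f" by (rule spectral_measure_UNIV[OF f])
  have int: "integrable ?N (\<lambda>t. t)"
    by (rule integrable_const_bound[where B = "max \<bar>a\<bar> \<bar>b\<bar>"])
      (use up lo in \<open>eventually_elim, auto\<close>, measurable)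
  have "AE t in ?N. norm (t\<^sup>2) \<le> (max \<bar>a\<bar> \<bar>b\<bar>)\<^sup>2"
    using up lo
  proof eventually_elim
    case (elim t)
    then have "\<bar>t\<bar> \<le> max \<bar>a\<bar> \<bar>b\<bar>" by auto
    then have "\<bar>t\<bar>\<^sup>2 \<le> (max \<bar>a\<bar> \<bar>b\<bar>)\<^sup>2" by (intro power_mono) auto
    then show ?case by simp
  qed
  then have "integrable ?N (\<lambda>t. t\<^sup>2)"
    by (rule integrable_const_bound) measurable
  then show "f \<in> Domain A" using f by (simp add: in_Domain_iff)
  have "(\<integral>t. a \<partial>?N) \<le> (\<integral>t. t \<partial>?N)"
    using lo int by (intro integral_mono_AE) (auto elim: eventually_mono)
  then show "a * L2_inner M f f \<le> L2_inner M f h" if "(f, h) \<in> A"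
    using A_quadratic_form[OF that] mass by (simp add: mult.commute)
  have "(\<integral>t. t \<partial>?N) \<le> (\<integral>t. b \<partial>?N)"
    using up int by (intro integral_mono_AE) auto
  then show "L2_inner M f h \<le> b * L2_inner M f f" if "(f, h) \<in> A"
    using A_quadratic_form[OF that] mass by (simp add: mult.commute)
qed

text \<open>\<open>E a\<close> and \<open>E b\<close> commute, so truncating at \<open>b\<close>
  from above preserves the vanishing of the part below \<open>a\<close>. Such truncations thus have
  bounded spectrum and lie in the domain.\<close>

lemma E_bounded_spectrum:
  assumes f: "f \<in> L2_space M" and low: "AE x in M. E a f x = 0"
  shows "AE x in M. E a (E b f) x = 0" and "AE x in M. E b (E b f) x = E b f x"
proof -
  have "AE x in M. E b (E a f) x = E b (\<lambda>_. 0) x"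
    using f low by (intro E_cong_AE) (auto simp: L2_zero)
  moreover have "AE x in M. E b (\<lambda>_. 0) x = 0"
    using E_sum[of 0 "\<lambda>_ _. 0" b "\<lambda>_. 0"] by simp
  ultimately show "AE x in M. E a (E b f) x = 0"
    using E_E[OF f, of a b] E_E[OF f, of b a] by eventually_elim (simp add: min.commute)
  show "AE x in M. E b (E b f) x = E b f x"
    using E_E[OF f, of b b] by simp
qed

text \<open>The operator commutes with its spectral projections; on the level of quadratic forms this is the
  additivity of the spectral measure over complementary half-lines.\<close>

lemma A_spectral_orthogonal_aux:
  assumes f: "f \<in> L2_space M" and low: "AE x in M. E a f x = 0" and "b \<le> c"
    and h: "(E b f, h) \<in> A"
  shows "L2_inner M (\<lambda>x. E c f x - E b f x) h = 0"
proof -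
  let ?y = "E c f"
  let ?x = "\<lambda>x. E c f x - E b f x"
  let ?N = "spectral_measure M E ?y"
  have y: "?y \<in> L2_space M" and x: "?x \<in> L2_space M" using f by (auto simp: L2_diff)
  have "?y \<in> Domain A"
    using bounded_spectrum(1)[OF y E_bounded_spectrum[OF f low]] .
  then obtain k where k: "(?y, k) \<in> A" by auto
  interpret finite_borel_measure ?N by (rule finite_spectral_measure[OF y])
  have sets [measurable_cong, simp]: "sets ?N = sets borel" and space [simp]: "space ?N = UNIV"
    by (simp_all add: spectral_measure_eq)
  have Ey: "AE x in M. E b ?y x = E b f x"
    using E_E[OF f, of b c] \<open>b \<le> c\<close> by (simp add: min_absorb1)
  have "spectral_measure M E (E b f) = spectral_measure M E (E b ?y)"
    using f by (intro spectral_measure_cong_AE) (use Ey in auto)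
  then have Nb: "spectral_measure M E (E b f) = density ?N (indicator {..b})"
    by (simp only: spectral_measure_E[OF y])
  have "spectral_measure M E ?x = spectral_measure M E (\<lambda>x. ?y x - E b ?y x)"
    using f by (intro spectral_measure_cong_AE) (use Ey in \<open>auto simp: L2_diff\<close>)
  then have Nx: "spectral_measure M E ?x = density ?N (indicator {b<..})"
    by (simp only: spectral_measure_diff_E[OF y])
  have "?y \<in> Domain A" using k by auto
  then have "integrable ?N (\<lambda>t. t\<^sup>2)" by (simp add: in_Domain_iff)
  then have int: "integrable ?N (\<lambda>t. t)"
    by (rule square_integrable_imp_integrable[rotated]) measurable
  have i1: "(\<integral>t. t \<partial>density ?N (indicator B)) = (\<integral>t. indicator B t * t \<partial>?N)" if "B \<in> sets borel" for B
  proof -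
    have "density ?N (indicator B) = density ?N (\<lambda>t. ennreal (indicator B t))"
      by (simp add: ennreal_indicator)
    then show ?thesis
      using integral_density[of "\<lambda>t. t" ?N "indicator B"] that by simp
  qed
  have "(\<integral>t. t \<partial>?N) = (\<integral>t. indicator {..b} t * t + indicator {b<..} t * t \<partial>?N)"
    by (intro Bochner_Integration.integral_cong) (auto simp: indicator_def)
  also have "\<dots> = (\<integral>t. indicator {..b} t * t \<partial>?N) + (\<integral>t. indicator {b<..} t * t \<partial>?N)"
    using int integrable_mult_indicator[of "{..b}" ?N "\<lambda>t. t"] integrable_mult_indicator[of "{b<..}" ?N "\<lambda>t. t"]
    by (intro Bochner_Integration.integral_add) auto
  \<comment> \<open>Additivity of the first moment over \<open>{..b}\<close> and
    \<open>{b<..}\<close>, read as quadratic forms. Expanding the last form bilinearly and using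
    symmetry for the mixed terms leaves twice the claimed inner product, equated to 0.\<close>
  finally have "L2_inner M ?y k = L2_inner M (E b f) h + L2_inner M ?x (\<lambda>x. k x - h x)"
    using A_quadratic_form[OF k] A_quadratic_form[OF h] A_quadratic_form[OF A_diff[OF k h]]
    by (simp add: Nb Nx i1)
  moreover have "L2_inner M ?x (\<lambda>x. k x - h x)
      = L2_inner M ?y k - L2_inner M (E b f) k - L2_inner M ?y h + L2_inner M (E b f) h"
    using A_L2[OF k] A_L2[OF h] by (simp add: L2_inner_diff_left L2_inner_diff_right L2_diff)
  moreover have "L2_inner M (E b f) k = L2_inner M ?y h"
    using A_symmetric[OF k h] by (simp add: L2_inner_commute)
  moreover have "L2_inner M ?x h = L2_inner M ?y h - L2_inner M (E b f) h"
    using A_L2[OF k] A_L2[OF h] by (simp add: L2_inner_diff_left)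
  ultimately show ?thesis by simp
qed

text \<open>Passage to \<open>f\<close> itself, which need not lie in the domain: the inner product
  of \<open>h\<close> with \<open>E c f\<close> is the same for all \<open>c \<ge> b\<close>, and
  \<open>E c f\<close> tends to \<open>f\<close>.\<close>

lemma A_spectral_orthogonal:
  assumes f: "f \<in> L2_space M" and low: "AE x in M. E a f x = 0" and h: "(E b f, h) \<in> A"
  shows "L2_inner M f h = L2_inner M (E b f) h"
proof -
  have hL: "h \<in> L2_space M" using A_L2 h by auto
  have "((\<lambda>c. L2_inner M h (E c f)) \<longlongrightarrow> L2_inner M h f) at_top"
    using f hL by (intro L2_inner_tendsto E_at_top) auto
  moreover have "eventually (\<lambda>c. L2_inner M h (E c f) = L2_inner M h (E b f)) at_top"
    using eventually_ge_at_top[of b]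
  proof eventually_elim
    case (elim c)
    then show ?case
      using A_spectral_orthogonal_aux[OF f low elim h] f hL
      by (simp add: L2_inner_diff_left L2_inner_commute[of M h])
  qed
  ultimately have "((\<lambda>_::real. L2_inner M h (E b f)) \<longlongrightarrow> L2_inner M h f) at_top"
    by (rule Lim_transform_eventually)
  then show ?thesis
    by (simp add: tendsto_const_iff L2_inner_commute[of M h])
qed

text \<open>On a vector with spectrum in \<open>(a, b]\<close> the form is at most \<open>b\<close>
  times the squared norm, which for \<open>b < 0\<close> contradicts nonnegativity unless the vector
  is 0. Hence the distribution function does not change below \<open>b\<close>, and its limit at
  minus infinity is 0.\<close>

lemma nonneg_imp_E_eq_0:
  assumes nonneg: "\<And>f u. (f, u) \<in> A \<Longrightarrow> 0 \<le> L2_inner M f u"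
    and f: "f \<in> L2_space M" and "b < 0"
  shows "AE x in M. E b f x = 0"
proof -
  have eq: "distribution f b = distribution f a" if "a < b" for a
  proof -
    let ?g = "\<lambda>x. f x - E a f x"
    have g: "?g \<in> L2_space M" using f by (simp add: L2_diff)
    have low: "AE x in M. E a ?g x = 0"
      using E_diff[OF f E_L2[OF f], of a a] E_E[OF f, of a a] by eventually_elim simp
    let ?v = "E b ?g"
    have v: "?v \<in> L2_space M" using g by simp
    note bounded = bounded_spectrum[OF v E_bounded_spectrum[OF g low]]
    obtain h where h: "(?v, h) \<in> A" using bounded(1) by auto
    have "0 \<le> b * L2_inner M ?v ?v"
      using bounded(3)[OF h] nonneg[OF h] by simp
    then have "L2_inner M ?v ?v = 0"
      using \<open>b < 0\<close> L2_inner_self_nonneg[of M ?v] by (simp add: zero_le_mult_iff)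
    then have "AE x in M. ?v x = 0"
      using L2_inner_self_eq_0_iff[OF v] by simp
    moreover have "AE x in M. ?v x = E b f x - E a f x"
      using E_diff[OF f E_L2[OF f], of b a] E_E[OF f, of b a]
      by eventually_elim (use \<open>a < b\<close> in \<open>simp add: min_absorb2\<close>)
    ultimately have "AE x in M. E b f x = E a f x" by eventually_elim simp
    then show ?thesis
      using f unfolding distribution_def by (intro L2_inner_cong_AE) (auto intro: L2_measurable)
  qed
  have "eventually (\<lambda>a. distribution f a = distribution f b) at_bot"
    using eventually_gt_at_bot[of b] by eventually_elim (simp add: eq)
  with distribution_at_bot[OF f] have "((\<lambda>_::real. distribution f b) \<longlongrightarrow> 0) at_bot"
    by (rule Lim_transform_eventually)
  then have "distribution f b = 0" by (simp add: tendsto_const_iff)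
  then show ?thesis using f by (simp add: distribution_eq L2_inner_self_eq_0_iff)
qed

end


section \<open>Smooth functions\<close>

lemma smooth_real_deriv: "smooth_real f \<Longrightarrow> smooth_real (deriv f)"
  unfolding smooth_real_def
proof (intro allI)
  fix n x
  assume "\<forall>n x. (deriv ^^ n) f field_differentiable at x"
  then have "(deriv ^^ Suc n) f field_differentiable at x" by blast
  then show "(deriv ^^ n) (deriv f) field_differentiable at x"
    by (simp add: funpow_swap1)
qed

lemma smooth_real_DERIV: "smooth_real f \<Longrightarrow> (f has_field_derivative deriv f x) (at x)"
  unfolding smooth_real_def by (metis field_differentiable_derivI funpow_0)

lemma smooth_real_continuous: "smooth_real f \<Longrightarrow> continuous_on S f"
  by (meson DERIV_isCont continuous_at_imp_continuous_on smooth_real_DERIV)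

text \<open>Membership in a class closed under differentiation replaces explicit formulas for higher
  derivatives.\<close>

lemma smooth_real_coinduct:
  assumes "S f"
    and "\<And>g. S g \<Longrightarrow> \<exists>g'. (\<forall>x. (g has_field_derivative g' x) (at x)) \<and> S g'"
  shows "smooth_real f"
proof -
  have step: "(\<forall>x. g field_differentiable at x) \<and> S (deriv g)" if "S g" for g
  proof -
    obtain g' where g': "\<And>x. (g has_field_derivative g' x) (at x)" "S g'"
      using assms(2)[OF \<open>S g\<close>] by blast
    then have "deriv g = g'" by (auto intro: DERIV_imp_deriv)
    with g' show ?thesis by (auto simp: field_differentiable_def)
  qed
  have "S ((deriv ^^ n) f)" for n
    by (induction n) (use assms(1) step in auto)
  then show ?thesis using step by (auto simp: smooth_real_def)
qed

lemma smooth_real_antiderivative: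
  assumes "\<And>x. (g has_field_derivative h x) (at x)" "smooth_real h"
  shows "smooth_real g"
proof (rule smooth_real_coinduct[where S = "\<lambda>f. f = g \<or> smooth_real f"])
  fix f assume "f = g \<or> smooth_real f"
  then show "\<exists>f'. (\<forall>x. (f has_field_derivative f' x) (at x)) \<and> (f' = g \<or> smooth_real f')"
    using assms smooth_real_DERIV smooth_real_deriv by blast
qed simp

lemma smooth_real_const: "smooth_real (\<lambda>_. c)"
  by (rule smooth_real_coinduct[where S = "\<lambda>f. \<exists>c. f = (\<lambda>_. c)"]) (auto intro!: exI derivative_eq_intros)

text \<open>The class below is closed under differentiation, so it consists of smooth functions.\<close>

inductive smooth_closure :: "(real \<Rightarrow> real) \<Rightarrow> bool" where
  base: "smooth_real f \<Longrightarrow> smooth_closure f"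
| add: "smooth_closure f \<Longrightarrow> smooth_closure g \<Longrightarrow> smooth_closure (\<lambda>x. f x + g x)"
| mult: "smooth_closure f \<Longrightarrow> smooth_closure g \<Longrightarrow> smooth_closure (\<lambda>x. f x * g x)"
| inverse: "smooth_closure f \<Longrightarrow> (\<And>x. f x \<noteq> 0) \<Longrightarrow> smooth_closure (\<lambda>x. inverse (f x))"

lemma smooth_closure_DERIV:
  "smooth_closure f \<Longrightarrow> \<exists>f'. (\<forall>x. (f has_field_derivative f' x) (at x)) \<and> smooth_closure f'"
proof (induction rule: smooth_closure.induct)
  case (base f)
  then show ?case using smooth_real_DERIV smooth_real_deriv smooth_closure.base by blast
next
  case (add f g)
  then obtain f' g' where
    "\<And>x. (f has_field_derivative f' x) (at x)" "smooth_closure f'"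
    "\<And>x. (g has_field_derivative g' x) (at x)" "smooth_closure g'" by blast
  then show ?case
    by (intro exI[of _ "\<lambda>x. f' x + g' x"]) (auto intro!: derivative_intros smooth_closure.add)
next
  case (mult f g)
  then obtain f' g' where
    d: "\<And>x. (f has_field_derivative f' x) (at x)" "smooth_closure f'"
    "\<And>x. (g has_field_derivative g' x) (at x)" "smooth_closure g'" by blast
  have "smooth_closure (\<lambda>x. f' x * g x + f x * g' x)"
    using mult d by (intro smooth_closure.add smooth_closure.mult)
  moreover have "((\<lambda>x. f x * g x) has_field_derivative f' x * g x + f x * g' x) (at x)" for x
    using d by (auto intro!: derivative_eq_intros)
  ultimately show ?case by (intro exI[of _ "\<lambda>x. f' x * g x + f x * g' x"]) simp
next
  case (inverse f)
  then obtain f' where d: "\<And>x. (f has_field_derivative f' x) (at x)" "smooth_closure f'" by blast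
  let ?g = "\<lambda>x. - 1 * (f' x * (inverse (f x) * inverse (f x)))"
  have "smooth_closure ?g"
    using inverse d
    by (intro smooth_closure.mult smooth_closure.inverse smooth_closure.base[OF smooth_real_const])
  moreover have "((\<lambda>x. inverse (f x)) has_field_derivative ?g x) (at x)" for x
    using d inverse by (auto intro!: derivative_eq_intros simp: divide_simps)
  ultimately show ?case by (intro exI[of _ ?g]) simp
qed

lemma smooth_closure_smooth: "smooth_closure f \<Longrightarrow> smooth_real f"
  by (rule smooth_real_coinduct[where S = smooth_closure]) (auto dest: smooth_closure_DERIV)

lemma smooth_real_add: "smooth_real f \<Longrightarrow> smooth_real g \<Longrightarrow> smooth_real (\<lambda>x. f x + g x)"
  by (rule smooth_closure_smooth[OF smooth_closure.add]) (auto intro: smooth_closure.base)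

lemma smooth_real_mult: "smooth_real f \<Longrightarrow> smooth_real g \<Longrightarrow> smooth_real (\<lambda>x. f x * g x)"
  by (rule smooth_closure_smooth[OF smooth_closure.mult]) (auto intro: smooth_closure.base)

lemma smooth_real_divide:
  "smooth_real f \<Longrightarrow> smooth_real g \<Longrightarrow> (\<And>x. g x \<noteq> 0) \<Longrightarrow> smooth_real (\<lambda>x. f x / g x)"
  unfolding divide_inverse
  by (rule smooth_closure_smooth[OF smooth_closure.mult[OF _ smooth_closure.inverse]])
    (auto intro: smooth_closure.base)

text \<open>The extra factor \<open>k\<close> in the invariant absorbs the powers of
  \<open>c\<close> produced by the chain rule.\<close>

lemma smooth_real_affine:
  assumes "smooth_real f"
  shows "smooth_real (\<lambda>x. f (c * x + d))"
proof (rule smooth_real_coinduct[where S = "\<lambda>g. \<exists>f k. smooth_real f \<and> g = (\<lambda>x. k * f (c * x + d))"])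
  show "\<exists>f' k. smooth_real f' \<and> (\<lambda>x. f (c * x + d)) = (\<lambda>x. k * f' (c * x + d))"
    using assms by (intro exI[of _ f] exI[of _ 1]) simp
next
  fix g assume "\<exists>f k. smooth_real f \<and> g = (\<lambda>x. k * f (c * x + d))"
  then obtain f k where f: "smooth_real f" and g: "g = (\<lambda>x. k * f (c * x + d))" by blast
  have "(g has_field_derivative (k * c) * deriv f (c * x + d)) (at x)" for x
  proof -
    have "((\<lambda>x. f (c * x + d)) has_field_derivative deriv f (c * x + d) * c) (at x)"
      by (rule DERIV_chain'[where f = "\<lambda>x. c * x + d"]) (auto intro!: derivative_eq_intros smooth_real_DERIV f)
    from DERIV_cmult[OF this, of k] show ?thesis
      unfolding g by (simp add: mult.assoc mult.commute mult.left_commute)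
  qed
  then show "\<exists>g'. (\<forall>x. (g has_field_derivative g' x) (at x)) \<and>
      (\<exists>f k. smooth_real f \<and> g' = (\<lambda>x. k * f (c * x + d)))"
    using smooth_real_deriv[OF f] by (intro exI[of _ "\<lambda>x. (k * c) * deriv f (c * x + d)"]) blast
qed

lemma test_functionsI:
  assumes "smooth_real f" "\<And>x. x \<notin> {a..b} \<Longrightarrow> f x = 0"
  shows "f \<in> test_functions"
proof -
  have "bounded {x. f x \<noteq> 0}"
    by (rule bounded_subset[OF bounded_closed_interval[of a b]]) (use assms(2) in blast)
  then show ?thesis using assms(1) by (simp add: test_functions_def)
qed


section \<open>Bump functions\<close>

text \<open>The polynomial in \<open>1 / x\<close> is carried along to make the family closed under
  differentiation; \<open>p = 1\<close> is the classical smooth function that is flat at 0.\<close>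

definition flat_exp :: "real poly \<Rightarrow> real \<Rightarrow> real" where
  "flat_exp p x = (if 0 < x then poly p (1 / x) * exp (- (1 / x)) else 0)"

lemma poly_times_exp_minus_tendsto_0: "((\<lambda>y. poly p y * exp (- y)) \<longlongrightarrow> (0::real)) at_top"
proof -
  have "((\<lambda>y. \<Sum>i\<le>degree p. coeff p i * (y ^ i / exp y)) \<longlongrightarrow> (\<Sum>i\<le>degree p. coeff p i * (0::real))) at_top"
    by (intro tendsto_sum tendsto_mult tendsto_const tendsto_power_div_exp_0)
  then show ?thesis
    by (simp add: poly_altdef exp_minus divide_inverse sum_distrib_right mult.assoc)
qed

lemma flat_exp_tendsto_0: "((\<lambda>x. flat_exp p x / x) \<longlongrightarrow> 0) (at 0)"
proof -
  have "((\<lambda>x. poly (pCons 0 p) (1 / x) * exp (- (1 / x))) \<longlongrightarrow> 0) (at_right 0)"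
    by (rule filterlim_compose[OF poly_times_exp_minus_tendsto_0])
      (simp add: filterlim_inverse_at_top_right flip: inverse_eq_divide)
  moreover have "eventually (\<lambda>x. poly (pCons 0 p) (1 / x) * exp (- (1 / x)) = flat_exp p x / x) (at_right 0)"
    using eventually_at_right_less[of 0] by eventually_elim (simp add: flat_exp_def)
  ultimately have "((\<lambda>x. flat_exp p x / x) \<longlongrightarrow> 0) (at_right 0)"
    by (rule Lim_transform_eventually)
  moreover have "((\<lambda>x. flat_exp p x / x) \<longlongrightarrow> 0) (at_left 0)"
    by (rule tendsto_eventually) (auto simp: flat_exp_def eventually_at_filter)
  ultimately show ?thesis by (simp add: filterlim_at_split)
qed

text \<open>Differentiating \<open>p(1/x) exp(-1/x)\<close> gives the factor \<open>(1/x)^2\<close>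
  times \<open>(p - p')(1/x)\<close>, hence the new polynomial \<open>X^2 (p - p')\<close>. At 0 the
  difference quotient is again an exponentially damped polynomial in \<open>1 / x\<close>.\<close>

lemma flat_exp_DERIV:
  "(flat_exp p has_field_derivative flat_exp (monom 1 2 * (p - pderiv p)) x) (at x)"
proof -
  consider "x < 0" | "x = 0" | "0 < x" by linarith
  then show ?thesis
  proof cases
    case 1
    have "((\<lambda>_. 0) has_field_derivative 0) (at x)" by simp
    then have "(flat_exp p has_field_derivative 0) (at x)"
      by (rule has_field_derivative_transform_within_open[where S = "{..<0}"])
        (use 1 in \<open>auto simp: flat_exp_def\<close>)
    then show ?thesis using 1 by (simp add: flat_exp_def)
  next
    case 2
    then show ?thesis
      using flat_exp_tendsto_0[of p] by (simp add: has_field_derivative_iff flat_exp_def)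
  next
    case 3
    have "((\<lambda>x. poly p (1 / x) * exp (- (1 / x))) has_field_derivative
        flat_exp (monom 1 2 * (p - pderiv p)) x) (at x)"
      using 3 by (auto intro!: derivative_eq_intros poly_DERIV[THEN DERIV_chain2]
          simp: flat_exp_def poly_monom power2_eq_square field_simps)
    then show ?thesis
      by (rule has_field_derivative_transform_within_open[where S = "{0<..}"])
        (use 3 in \<open>auto simp: flat_exp_def\<close>)
  qed
qed

lemma smooth_flat_exp: "smooth_real (flat_exp p)"
  by (rule smooth_real_coinduct[where S = "\<lambda>f. \<exists>p. f = flat_exp p"]) (use flat_exp_DERIV in blast)+

text \<open>Larger \<open>n\<close> steepens both flanks: the bumps stay between 0 and 1 and tend to
  the indicator of the open interval.\<close>

definition bump :: "real \<Rightarrow> real \<Rightarrow> nat \<Rightarrow> real \<Rightarrow> real" where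
  "bump a b n x = flat_exp 1 (real (Suc n) * (x - a)) * flat_exp 1 (real (Suc n) * (b - x))"

lemma smooth_bump: "smooth_real (bump a b n)"
proof -
  have "smooth_real (\<lambda>x. flat_exp 1 (real (Suc n) * x + (- real (Suc n) * a))
      * flat_exp 1 ((- real (Suc n)) * x + real (Suc n) * b))"
    by (intro smooth_real_mult smooth_real_affine smooth_flat_exp)
  also have "\<dots> = bump a b n"
    by (rule ext) (simp add: bump_def algebra_simps)
  finally show ?thesis .
qed

lemma bump_outside: "x \<notin> {a<..<b} \<Longrightarrow> bump a b n x = 0"
  by (auto simp: bump_def flat_exp_def zero_less_mult_iff)

lemma flat_exp_1_bounds: "0 \<le> flat_exp 1 x" "flat_exp 1 x \<le> 1"
  by (auto simp: flat_exp_def)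

lemma bump_nonneg: "0 \<le> bump a b n x"
  by (simp add: bump_def flat_exp_1_bounds)

lemma bump_le_1: "bump a b n x \<le> 1"
  by (simp add: bump_def flat_exp_1_bounds mult_le_one)

lemma bump_pos: "x \<in> {a<..<b} \<Longrightarrow> 0 < bump a b n x"
  by (auto simp: bump_def flat_exp_def zero_less_mult_iff)

lemma flat_exp_1_scaled_tendsto:
  assumes "0 < y"
  shows "(\<lambda>n. flat_exp 1 (real (Suc n) * y)) \<longlonglongrightarrow> 1"
proof -
  have "(\<lambda>n. exp (- (1 / real (Suc n)) * (1 / y))) \<longlonglongrightarrow> exp (- 0 * (1 / y))"
    by (intro tendsto_intros LIMSEQ_inverse_real_of_nat[unfolded inverse_eq_divide])
  then show ?thesis
    using assms by (simp add: flat_exp_def zero_less_mult_iff)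
qed

lemma bump_tendsto: "(\<lambda>n. bump a b n x) \<longlonglongrightarrow> indicator {a<..<b} x"
proof (cases "x \<in> {a<..<b}")
  case True
  then have "(\<lambda>n. bump a b n x) \<longlonglongrightarrow> 1 * 1"
    unfolding bump_def by (intro tendsto_mult flat_exp_1_scaled_tendsto) auto
  with True show ?thesis by simp
qed (simp add: bump_outside)


section \<open>Integration against compactly supported functions\<close>

lemma integrable_mult_compact_support:
  fixes \<phi> g :: "real \<Rightarrow> real"
  assumes \<phi>: "continuous_on UNIV \<phi>" "\<And>x. x \<notin> {a..b} \<Longrightarrow> \<phi> x = 0"
    and g: "g \<in> borel_measurable borel" "set_integrable lborel {a..b} g"
  shows "integrable lborel (\<lambda>x. \<phi> x * g x)"
proof -
  have "compact (\<phi> ` {a..b})"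
    using \<phi>(1) by (intro compact_continuous_image) (auto intro: continuous_on_subset)
  then have "bounded (\<phi> ` {a..b})" by (rule compact_imp_bounded)
  then obtain B where B: "\<And>x. x \<in> {a..b} \<Longrightarrow> \<bar>\<phi> x\<bar> \<le> B"
    unfolding bounded_iff by (metis imageI real_norm_def)
  show ?thesis
  proof (rule Bochner_Integration.integrable_bound)
    show "integrable lborel (\<lambda>x. B * (indicator {a..b} x *\<^sub>R g x))"
      using g(2) by (simp add: set_integrable_def)
    show "(\<lambda>x. \<phi> x * g x) \<in> borel_measurable lborel"
      using borel_measurable_continuous_onI[OF \<phi>(1)] g(1) by simp
    have "\<bar>\<phi> x * g x\<bar> \<le> \<bar>B * (indicator {a..b} x *\<^sub>R g x)\<bar>" for x
    proof (cases "x \<in> {a..b}")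
      case True
      then have "\<bar>\<phi> x\<bar> \<le> \<bar>B\<bar>" using B[OF True] by linarith
      then show ?thesis using True by (auto simp: abs_mult intro!: mult_right_mono)
    qed (simp add: \<phi>(2))
    then show "AE x in lborel. norm (\<phi> x * g x) \<le> norm (B * (indicator {a..b} x *\<^sub>R g x))"
      by simp
  qed
qed

lemma integrable_continuous_compact_support:
  fixes \<phi> :: "real \<Rightarrow> real"
  assumes "continuous_on UNIV \<phi>" "\<And>x. x \<notin> {a..b} \<Longrightarrow> \<phi> x = 0"
  shows "integrable lborel \<phi>"
proof -
  have "set_integrable lborel {a..b} (\<lambda>_. 1::real)"
    by (intro borel_integrable_atLeastAtMost' continuous_intros)
  from integrable_mult_compact_support[OF assms _ this] show ?thesis by simp
qed

lemma integral_deriv_compact_support: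
  fixes p p' :: "real \<Rightarrow> real"
  assumes p: "\<And>x. (p has_field_derivative p' x) (at x)" "continuous_on UNIV p'"
    and supp: "\<And>x. x \<notin> {a..b} \<Longrightarrow> p x = 0"
  shows "\<And>x. x \<notin> {a..b} \<Longrightarrow> p' x = 0" and "integrable lborel p'" and "(\<integral>x. p' x \<partial>lborel) = 0"
proof -
  show 0: "p' x = 0" if "x \<notin> {a..b}" for x
  proof -
    have "((\<lambda>_. 0) has_field_derivative 0) (at x)" by simp
    then have "(p has_field_derivative 0) (at x)"
      by (rule has_field_derivative_transform_within_open[where S = "- {a..b}"])
        (use that supp in \<open>auto simp: open_Compl\<close>)
    with p(1) show ?thesis by (rule DERIV_unique)
  qed
  show "integrable lborel p'" by (rule integrable_continuous_compact_support[OF p(2) 0])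
  \<comment> \<open>\<open>min\<close> and \<open>max\<close> cover an empty interval
    \<open>{a..b}\<close>, and the margin 1 places both ends outside the support.\<close>
  define c where "c = min a b - 1"
  define d where "d = max a b + 1"
  have "(\<integral>x. p' x \<partial>lborel) = (\<integral>x. indicator {c..d} x *\<^sub>R p' x \<partial>lborel)"
  proof (rule Bochner_Integration.integral_cong)
    fix x show "p' x = indicator {c..d} x *\<^sub>R p' x"
      using 0[of x] by (cases "x \<in> {a..b}") (auto simp: c_def d_def)
  qed simp
  also have "\<dots> = p d - p c"
  proof (rule integral_FTC_atLeastAtMost)
    show "c \<le> d" by (simp add: c_def d_def)
    show "(p has_vector_derivative p' x) (at x within {c..d})" for x
      using p(1) by (simp add: has_field_derivative_at_within flip: has_real_derivative_iff_has_vector_derivative)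
    show "continuous_on {c..d} p'" using p(2) by (rule continuous_on_subset) simp
  qed
  also have "\<dots> = 0" by (subst (1 2) supp) (auto simp: c_def d_def)
  finally show "(\<integral>x. p' x \<partial>lborel) = 0" .
qed

lemma everywhere_DERIV_continuous_on: "(\<And>x. (p has_field_derivative p' x) (at x)) \<Longrightarrow> continuous_on S p"
  for p :: "real \<Rightarrow> real"
  by (meson DERIV_isCont continuous_at_imp_continuous_on)

lemma integral_by_parts_compact_support:
  fixes \<phi> G :: "real \<Rightarrow> real"
  assumes \<phi>: "\<And>x. (\<phi> has_field_derivative \<phi>' x) (at x)" "continuous_on UNIV \<phi>'"
    and supp: "\<And>x. x \<notin> {a..b} \<Longrightarrow> \<phi> x = 0"
    and G: "\<And>x. (G has_field_derivative G' x) (at x)" "continuous_on UNIV G'"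
  shows "(\<integral>x. \<phi> x * G' x \<partial>lborel) = - (\<integral>x. \<phi>' x * G x \<partial>lborel)"
proof -
  have c: "continuous_on UNIV \<phi>" "continuous_on UNIV G"
    using everywhere_DERIV_continuous_on \<phi>(1) G(1) by blast+
  have int: "integrable lborel (\<lambda>x. \<phi>' x * G x)" "integrable lborel (\<lambda>x. \<phi> x * G' x)"
    using integral_deriv_compact_support(1)[OF \<phi> supp] supp
    by (auto intro!: integrable_continuous_compact_support[where a = a and b = b] continuous_intros c \<phi> G)
  have "(\<integral>x. \<phi>' x * G x + \<phi> x * G' x \<partial>lborel) = 0"
    by (rule integral_deriv_compact_support(3)[where p = "\<lambda>x. \<phi> x * G x" and a = a and b = b])
      (auto intro!: derivative_eq_intros \<phi> G continuous_intros c simp: supp)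
  then show ?thesis using int by simp
qed

lemma isCont_integral_Iic:
  fixes g :: "real \<Rightarrow> real"
  assumes g: "integrable lborel g"
  shows "isCont (\<lambda>y. \<integral>x. indicator {..y} x * g x \<partial>lborel) y"
  unfolding isCont_def
proof (rule tendsto_at_iff_sequentially[THEN iffD2], intro allI impI)
  fix Y assume "\<forall>i. Y i \<in> UNIV - {y}" "Y \<longlonglongrightarrow> y"
  have [measurable]: "g \<in> borel_measurable borel" using g by auto
  show "((\<lambda>y. \<integral>x. indicator {..y} x * g x \<partial>lborel) \<circ> Y) \<longlonglongrightarrow> (\<integral>x. indicator {..y} x * g x \<partial>lborel)"
    unfolding comp_def
  proof (rule integral_dominated_convergence[where w = "\<lambda>x. \<bar>g x\<bar>"])
    show "AE x in lborel. (\<lambda>n. indicator {..Y n} x * g x) \<longlonglongrightarrow> indicator {..y} x * g x"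
      using AE_lborel_singleton[of y]
    proof eventually_elim
      case (elim x)
      have "eventually (\<lambda>n. indicator {..y} x * g x = indicator {..Y n} x * g x) sequentially"
      proof (cases "x < y")
        case True
        from order_tendstoD(1)[OF \<open>Y \<longlonglongrightarrow> y\<close> True] show ?thesis
          by eventually_elim (use True in auto)
      next
        case False
        then have "y < x" using elim by simp
        from order_tendstoD(2)[OF \<open>Y \<longlonglongrightarrow> y\<close> this] show ?thesis
          by eventually_elim (use \<open>y < x\<close> in auto)
      qed
      then show ?case by (rule Lim_transform_eventually[OF tendsto_const])
    qed
    show "AE x in lborel. norm (indicator {..Y n} x * g x) \<le> \<bar>g x\<bar>" for n
      by (simp add: indicator_def)
  qed (use g in auto)
qed

lemma integral_by_parts_integrable:
  fixes \<phi> g :: "real \<Rightarrow> real"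
  assumes \<phi>: "\<And>x. (\<phi> has_field_derivative \<phi>' x) (at x)" "continuous_on UNIV \<phi>'"
    and supp: "\<And>x. x \<notin> {a..b} \<Longrightarrow> \<phi> x = 0"
    and g: "integrable lborel g"
  shows "(\<integral>x. \<phi> x * g x \<partial>lborel) = - (\<integral>y. \<phi>' y * (\<integral>x. indicator {..y} x * g x \<partial>lborel) \<partial>lborel)"
proof -
  have supp': "\<phi>' x = 0" if "x \<notin> {a..b}" for x
    using integral_deriv_compact_support(1)[OF \<phi> supp that] .
  have int': "integrable lborel \<phi>'"
    using integral_deriv_compact_support(2)[OF \<phi> supp] .
  have [measurable]: "g \<in> borel_measurable borel" "\<phi>' \<in> borel_measurable borel"
    using g int' by auto
  have tail: "(\<integral>y. indicator {x..} y * \<phi>' y \<partial>lborel) = - \<phi> x" for x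
  proof -
    define d where "d = max x (max a b) + 1"
    have "(\<integral>y. indicator {x..} y * \<phi>' y \<partial>lborel) = (\<integral>y. indicator {x..d} y *\<^sub>R \<phi>' y \<partial>lborel)"
    proof (rule Bochner_Integration.integral_cong)
      fix y show "indicator {x..} y * \<phi>' y = indicator {x..d} y *\<^sub>R \<phi>' y"
        using supp'[of y] by (cases "y \<in> {a..b}") (auto simp: d_def indicator_def)
    qed simp
    also have "\<dots> = \<phi> d - \<phi> x"
    proof (rule integral_FTC_atLeastAtMost)
      show "x \<le> d" by (simp add: d_def)
      show "(\<phi> has_vector_derivative \<phi>' y) (at y within {x..d})" for y
        using \<phi>(1) by (simp add: has_field_derivative_at_within flip: has_real_derivative_iff_has_vector_derivative)
      show "continuous_on {x..d} \<phi>'" using \<phi>(2) by (rule continuous_on_subset) simp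
    qed
    also have "\<dots> = - \<phi> x" by (subst supp[of d]) (auto simp: d_def)
    finally show ?thesis .
  qed
  have meas: "(\<lambda>(x, y). indicator {..y} x * g x * \<phi>' y) \<in> borel_measurable (lborel \<Otimes>\<^sub>M lborel)"
  proof -
    have "(\<lambda>(x, y). indicator {..y} x * g x * \<phi>' y) = (\<lambda>z. (if fst z \<le> snd z then g (fst z) * \<phi>' (snd z) else 0))"
      by (auto simp: fun_eq_iff indicator_def)
    also have "\<dots> \<in> borel_measurable (lborel \<Otimes>\<^sub>M lborel)" by measurable
    finally show ?thesis .
  qed
  have "integrable (lborel \<Otimes>\<^sub>M lborel) (\<lambda>(x, y). indicator {..y} x * g x * \<phi>' y)"
  proof (rule Bochner_Integration.integrable_bound[OF _ meas])
    show "integrable (lborel \<Otimes>\<^sub>M lborel) (\<lambda>(x, y). g x * \<phi>' y)"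
    proof (rule lborel_pair.Fubini_integrable)
      show "integrable lborel (\<lambda>x. \<integral>y. norm (case (x, y) of (x, y) \<Rightarrow> g x * \<phi>' y) \<partial>lborel)"
        using g int' by (simp add: abs_mult)
    qed (use g int' in simp_all)
  qed (auto simp: indicator_def)
  note fubini = lborel_pair.Fubini_integral[OF this]
  have "(\<integral>y. \<phi>' y * (\<integral>x. indicator {..y} x * g x \<partial>lborel) \<partial>lborel)
      = (\<integral>y. (\<integral>x. indicator {..y} x * g x * \<phi>' y \<partial>lborel) \<partial>lborel)"
    by (simp add: mult.commute)
  also have "\<dots> = (\<integral>x. (\<integral>y. indicator {..y} x * g x * \<phi>' y \<partial>lborel) \<partial>lborel)"
    by (rule fubini)
  also have "\<dots> = (\<integral>x. (\<integral>y. g x * (indicator {x..} y * \<phi>' y) \<partial>lborel) \<partial>lborel)"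
    by (intro Bochner_Integration.integral_cong refl) (auto simp: indicator_def)
  also have "\<dots> = - (\<integral>x. \<phi> x * g x \<partial>lborel)"
    by (simp only: integral_mult_right_zero tail) (simp add: mult.commute)
  finally show ?thesis by simp
qed


section \<open>The lemma of du Bois-Reymond\<close>

text \<open>The positive and the negative part of \<open>h\<close> are densities of finite measures
  with the same cdf, so they agree a.e.; as one of them is 0 at each point, both vanish.\<close>

lemma integral_Iic_eq_0_imp_AE_eq_0:
  fixes h :: "real \<Rightarrow> real"
  assumes h: "integrable lborel h" and 0: "\<And>t. (\<integral>x. indicator {..t} x * h x \<partial>lborel) = 0"
  shows "AE x in lborel. h x = 0"
proof -
  have [measurable]: "h \<in> borel_measurable borel" using h by auto
  \<comment> \<open>\<open>s = 1\<close> gives the positive part and \<open>s = - 1\<close> the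
    negative part.\<close>
  define D where "D s = density lborel (\<lambda>x. ennreal (max (s * h x) 0))" for s
  have D: "finite_borel_measure (D s)"
    and cdf: "cdf (D s) t = (\<integral>x. indicator {..t} x * max (s * h x) 0 \<partial>lborel)" for s t
  proof -
    have int: "integrable lborel (\<lambda>x. indicator X x * max (s * h x) 0)" if [measurable]: "X \<in> sets borel" for X
      by (rule Bochner_Integration.integrable_bound[where f = "\<lambda>x. s * h x"])
        (use h in \<open>auto simp: indicator_def\<close>)
    have e: "emeasure (D s) X = ennreal (\<integral>x. indicator X x * max (s * h x) 0 \<partial>lborel)"
      if [measurable]: "X \<in> sets borel" for X
    proof -
      have "emeasure (D s) X = (\<integral>\<^sup>+x. ennreal (indicator X x * max (s * h x) 0) \<partial>lborel)"
        unfolding D_def by (subst emeasure_density) (auto intro!: nn_integral_cong simp: indicator_def)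
      also have "\<dots> = ennreal (\<integral>x. indicator X x * max (s * h x) 0 \<partial>lborel)"
        by (rule nn_integral_eq_integral[OF int]) auto
      finally show ?thesis .
    qed
    show "finite_borel_measure (D s)"
    proof (intro finite_borel_measure.intro finite_measureI finite_borel_measure_axioms.intro)
      show "emeasure (D s) (space (D s)) \<noteq> \<infinity>" using e[of UNIV] by (simp add: D_def)
    qed (simp add: D_def)
    show "cdf (D s) t = (\<integral>x. indicator {..t} x * max (s * h x) 0 \<partial>lborel)"
      unfolding cdf_def measure_def by (subst e) (auto intro!: enn2real_ennreal Bochner_Integration.integral_nonneg)
  qed
  have "cdf (D 1) = cdf (D (- 1))"
  proof
    fix t
    have int: "integrable lborel (\<lambda>x. indicator {..t} x * max (s * h x) 0)" for s
      by (rule Bochner_Integration.integrable_bound[where f = "\<lambda>x. s * h x"])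
        (use h in \<open>auto simp: indicator_def\<close>)
    have "cdf (D 1) t - cdf (D (- 1)) t
        = (\<integral>x. indicator {..t} x * max (1 * h x) 0 - indicator {..t} x * max (- 1 * h x) 0 \<partial>lborel)"
      unfolding cdf using int[of 1] int[of "- 1"] by (intro Bochner_Integration.integral_diff[symmetric])
    also have "\<dots> = (\<integral>x. indicator {..t} x * h x \<partial>lborel)"
      by (intro Bochner_Integration.integral_cong refl) (auto simp: indicator_def)
    finally show "cdf (D 1) t = cdf (D (- 1)) t" using 0 by simp
  qed
  then have "D 1 = D (- 1)" by (intro cdf_unique' D)
  then have "AE x in lborel. ennreal (max (1 * h x) 0) = ennreal (max (- 1 * h x) 0)"
    unfolding D_def by (subst sigma_finite_measure.density_unique_iff[OF sigma_finite_lborel, symmetric]) auto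
  then show ?thesis
    by eventually_elim (auto simp: max_def ennreal_eq_0_iff split: if_splits)
qed

text \<open>Bumps tend boundedly to indicators, so \<open>g\<close> integrates to 0 over every
  bounded open interval. Local integrability makes it necessary to cut down to
  \<open>(-N, N)\<close> before comparing cdfs; countably many \<open>N\<close> cover the
  line.\<close>

lemma fundamental_lemma:
  fixes g :: "real \<Rightarrow> real"
  assumes g: "g \<in> borel_measurable borel" "\<And>a b. set_integrable lborel {a..b} g"
    and weak: "\<And>\<eta> a b. smooth_real \<eta> \<Longrightarrow> (\<And>x. x \<notin> {a..b} \<Longrightarrow> \<eta> x = 0) \<Longrightarrow> (\<integral>x. \<eta> x * g x \<partial>lborel) = 0"
  shows "AE x in lborel. g x = 0"
proof -
  note [measurable] = g(1)
  have int: "integrable lborel (\<lambda>x. indicator {a..b} x * g x)" for a b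
    using g(2)[of a b] by (simp add: set_integrable_def)
  have Ioo: "(\<integral>x. indicator {a<..<b} x * g x \<partial>lborel) = 0" for a b
  proof -
    have "(\<lambda>n. \<integral>x. bump a b n x * g x \<partial>lborel) \<longlonglongrightarrow> (\<integral>x. indicator {a<..<b} x * g x \<partial>lborel)"
    proof (rule integral_dominated_convergence[where w = "\<lambda>x. \<bar>indicator {a..b} x * g x\<bar>"])
      show "AE x in lborel. (\<lambda>n. bump a b n x * g x) \<longlonglongrightarrow> indicator {a<..<b} x * g x"
        by (intro AE_I2 tendsto_mult bump_tendsto tendsto_const)
      show "(\<lambda>x. bump a b n x * g x) \<in> borel_measurable lborel" for n
        using borel_measurable_continuous_onI[OF smooth_real_continuous[OF smooth_bump]] by measurable
      show "AE x in lborel. norm (bump a b n x * g x) \<le> \<bar>indicator {a..b} x * g x\<bar>" for n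
      proof (rule AE_I2)
        fix x
        show "norm (bump a b n x * g x) \<le> \<bar>indicator {a..b} x * g x\<bar>"
        proof (cases "x \<in> {a<..<b}")
          case True
          then show ?thesis
            using bump_le_1[of a b n x] bump_nonneg[of a b n x]
            by (auto simp: abs_mult intro!: mult_left_le_one_le)
        qed (simp add: bump_outside)
      qed
    qed (use int in auto)
    moreover have "(\<integral>x. bump a b n x * g x \<partial>lborel) = 0" for n
      by (rule weak[OF smooth_bump, of a b]) (auto intro: bump_outside)
    ultimately show ?thesis by (simp add: LIMSEQ_const_iff)
  qed
  have "AE x in lborel. indicator {- real N<..<real N} x * g x = 0" for N
  proof (rule integral_Iic_eq_0_imp_AE_eq_0)
    show "integrable lborel (\<lambda>x. indicator {- real N<..<real N} x * g x)"
      by (rule Bochner_Integration.integrable_bound[OF int[of "- real N" "real N"]]) (auto simp: indicator_def)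
    fix t
    have "(\<integral>x. indicator {..t} x * (indicator {- real N<..<real N} x * g x) \<partial>lborel)
        = (\<integral>x. indicator {- real N<..<min t (real N)} x * g x \<partial>lborel)"
    proof (rule integral_cong_AE)
      show "AE x in lborel. indicator {..t} x * (indicator {- real N<..<real N} x * g x)
          = indicator {- real N<..<min t (real N)} x * g x"
        using AE_lborel_singleton[of t] by eventually_elim (auto simp: indicator_def)
    qed measurable
    then show "(\<integral>x. indicator {..t} x * (indicator {- real N<..<real N} x * g x) \<partial>lborel) = 0"
      by (simp add: Ioo)
  qed
  then have "AE x in lborel. \<forall>N. indicator {- real N<..<real N} x * g x = 0"
    by (simp only: AE_all_countable) blast
  then show ?thesis
  proof eventually_elim
    case (elim x)
    obtain N where "\<bar>x\<bar> < real N" using reals_Archimedean2 by blast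
    then have "x \<in> {- real N<..<real N}" by auto
    with elim[rule_format, of N] show ?case by simp
  qed
qed

text \<open>Second-order version: \<open>1\<close> and \<open>K\<close> span the solutions of \<open>((1 / K') g')' = 0\<close>. Two bumps on which \<open>K\<close>
  has different averages correct an arbitrary test function to one with vanishing moments.\<close>

lemma du_Bois_Reymond:
  fixes g K :: "real \<Rightarrow> real"
  assumes g: "g \<in> borel_measurable borel" "\<And>a b. set_integrable lborel {a..b} g"
    and K: "continuous_on UNIV K" "mono K" "K 1 < K 2"
    and weak: "\<And>\<eta> a b. smooth_real \<eta> \<Longrightarrow> (\<And>x. x \<notin> {a..b} \<Longrightarrow> \<eta> x = 0) \<Longrightarrow>
      (\<integral>x. \<eta> x \<partial>lborel) = 0 \<Longrightarrow> (\<integral>x. \<eta> x * K x \<partial>lborel) = 0 \<Longrightarrow> (\<integral>x. \<eta> x * g x \<partial>lborel) = 0"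
  shows "\<exists>\<alpha> \<beta>. AE x in lborel. g x = \<alpha> + \<beta> * K x"
proof -
  have Kint: "set_integrable lborel {a..b} K" for a b
    using K(1) by (intro borel_integrable_atLeastAtMost') (rule continuous_on_subset, auto)
  have Kmeas: "K \<in> borel_measurable borel"
    using K(1) by (rule borel_measurable_continuous_onI)
  \<comment> \<open>The supports are separated by \<open>1\<close> and \<open>2\<close>: by
    monotonicity the average of \<open>K\<close> is at most \<open>K 1\<close> under the first bump
    and at least \<open>K 2\<close> under the second.\<close>
  define e1 where "e1 = bump 0 1 0"
  define e2 where "e2 = bump 2 3 0"
  have e: "smooth_real e1" "smooth_real e2" by (simp_all add: e1_def e2_def smooth_bump)
  have supp: "e1 x = 0" if "x \<notin> {0..1}" for x using that by (auto simp: e1_def intro: bump_outside)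
  have supp2: "e2 x = 0" if "x \<notin> {2..3}" for x using that by (auto simp: e2_def intro: bump_outside)
  have ints: "integrable lborel \<eta>" "integrable lborel (\<lambda>x. \<eta> x * K x)" "integrable lborel (\<lambda>x. \<eta> x * g x)"
    if "smooth_real \<eta>" "\<And>x. x \<notin> {a..b} \<Longrightarrow> \<eta> x = 0" for \<eta> a b
    using integrable_continuous_compact_support[OF smooth_real_continuous[OF that(1)] that(2)]
      integrable_mult_compact_support[OF smooth_real_continuous[OF that(1)] that(2) Kmeas Kint]
      integrable_mult_compact_support[OF smooth_real_continuous[OF that(1)] that(2) g]
    by simp_all
  note int1 = ints[OF e(1) supp] and int2 = ints[OF e(2) supp2]
  define m1 where "m1 = (\<integral>x. e1 x \<partial>lborel)"
  define m2 where "m2 = (\<integral>x. e2 x \<partial>lborel)"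
  define k1 where "k1 = (\<integral>x. e1 x * K x \<partial>lborel)"
  define k2 where "k2 = (\<integral>x. e2 x * K x \<partial>lborel)"
  define g1 where "g1 = (\<integral>x. e1 x * g x \<partial>lborel)"
  define g2 where "g2 = (\<integral>x. e2 x * g x \<partial>lborel)"
  have pos: "0 < (\<integral>x. bump a b 0 x \<partial>lborel)" if "a < b" "integrable lborel (bump a b 0)" for a b
  proof -
    have "(\<integral>x. bump a b 0 x \<partial>lborel) \<noteq> 0"
    proof
      assume "(\<integral>x. bump a b 0 x \<partial>lborel) = 0"
      then have "AE x in lborel. bump a b 0 x = 0"
        using integral_nonneg_eq_0_iff_AE[OF that(2)] bump_nonneg by simp
      then have "AE x in lborel. x \<notin> {a<..<b}"
      proof eventually_elim
        case (elim x)
        then show ?case using bump_pos[of x a b 0] by linarith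
      qed
      then have "emeasure lborel {a<..<b} = 0"
        by (subst (asm) AE_iff_measurable[where N = "{a<..<b}"]) auto
      then show False using \<open>a < b\<close> by simp
    qed
    then show ?thesis
      using Bochner_Integration.integral_nonneg[of lborel "bump a b 0"] bump_nonneg by (simp add: less_le)
  qed
  have m: "0 < m1" "0 < m2"
    unfolding m1_def m2_def e1_def e2_def using int1(1) int2(1) by (auto intro!: pos simp: e1_def e2_def)
  have "k1 \<le> (\<integral>x. e1 x * K 1 \<partial>lborel)"
    unfolding k1_def
  proof (rule integral_mono)
    fix x show "e1 x * K x \<le> e1 x * K 1"
      using supp[of x] bump_nonneg[of 0 1 0 x] monoD[OF K(2), of x 1]
      by (cases "x \<in> {0..1}") (auto simp: e1_def intro!: mult_left_mono)
  qed (use int1 in auto)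
  then have k1: "k1 \<le> m1 * K 1" by (simp add: m1_def)
  have "(\<integral>x. e2 x * K 2 \<partial>lborel) \<le> k2"
    unfolding k2_def
  proof (rule integral_mono)
    fix x show "e2 x * K 2 \<le> e2 x * K x"
      using supp2[of x] bump_nonneg[of 2 3 0 x] monoD[OF K(2), of 2 x]
      by (cases "x \<in> {2..3}") (auto simp: e2_def intro!: mult_left_mono)
  qed (use int2 in auto)
  then have k2: "m2 * K 2 \<le> k2" by (simp add: m2_def)
  \<comment> \<open>Determinant of the system expressing that a combination of \<open>e1\<close> and
    \<open>e2\<close> has prescribed integrals against \<open>1\<close> and
    \<open>K\<close>.\<close>
  define \<Delta> where "\<Delta> = m1 * k2 - m2 * k1"
  have "m2 * k1 \<le> m2 * (m1 * K 1)" using k1 m by (intro mult_left_mono) auto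
  also have "\<dots> < m1 * (m2 * K 2)" using m K(3) by (simp add: mult.left_commute)
  also have "\<dots> \<le> m1 * k2" using k2 m by (intro mult_left_mono) auto
  finally have \<Delta>: "\<Delta> > 0" by (simp add: \<Delta>_def)
  \<comment> \<open>Cramer's rule: these coefficients give \<open>\<alpha> + \<beta> * K\<close> the
    same integrals as \<open>g\<close> against \<open>e1\<close> and \<open>e2\<close>.\<close>
  define \<alpha> where "\<alpha> = (k2 * g1 - k1 * g2) / \<Delta>"
  define \<beta> where "\<beta> = (m1 * g2 - m2 * g1) / \<Delta>"
  have "AE x in lborel. g x - (\<alpha> + \<beta> * K x) = 0"
  proof (rule fundamental_lemma)
    show "(\<lambda>x. g x - (\<alpha> + \<beta> * K x)) \<in> borel_measurable borel"
      using g(1) Kmeas by measurable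
    show "set_integrable lborel {a..b} (\<lambda>x. g x - (\<alpha> + \<beta> * K x))" for a b
    proof (rule set_integral_diff(1)[OF g(2)])
      show "set_integrable lborel {a..b} (\<lambda>x. \<alpha> + \<beta> * K x)"
        by (intro borel_integrable_atLeastAtMost' continuous_intros continuous_on_subset[OF K(1)]) auto
    qed
    fix \<eta> a b assume \<eta>: "smooth_real \<eta>" "\<And>x. x \<notin> {a..b} \<Longrightarrow> \<eta> x = 0"
    note int = ints[OF \<eta>]
    define m where "m = (\<integral>x. \<eta> x \<partial>lborel)"
    define k where "k = (\<integral>x. \<eta> x * K x \<partial>lborel)"
    \<comment> \<open>Cramer's rule for the same matrix: subtracting \<open>s\<close> times
      \<open>e1\<close> and \<open>t\<close> times \<open>e2\<close> cancels both moments of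
      \<open>\<eta>\<close>.\<close>
    define s where "s = (m * k2 - k * m2) / \<Delta>"
    define t where "t = (m1 * k - k1 * m) / \<Delta>"
    let ?\<theta> = "\<lambda>x. \<eta> x + (- s) * e1 x + (- t) * e2 x"
    have "(\<integral>x. ?\<theta> x * g x \<partial>lborel) = 0"
    proof (rule weak[where a = "min a 0" and b = "max b 3"])
      show "smooth_real ?\<theta>"
        using \<eta>(1) e by (intro smooth_real_add smooth_real_mult smooth_real_const)
      show "?\<theta> x = 0" if "x \<notin> {min a 0..max b 3}" for x
      proof -
        have "x \<notin> {a..b}" "x \<notin> {0..1}" "x \<notin> {2..3}" using that by auto
        then show ?thesis by (simp add: \<eta>(2) supp supp2 del: atLeastAtMost_iff)
      qed
      have "(\<integral>x. ?\<theta> x \<partial>lborel) = m - s * m1 - t * m2"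
        using int int1 int2 by (simp add: m_def m1_def m2_def)
      also have "\<dots> = 0" using \<Delta> by (simp add: s_def t_def field_simps) (simp add: \<Delta>_def algebra_simps)
      finally show "(\<integral>x. ?\<theta> x \<partial>lborel) = 0" .
      have "(\<integral>x. ?\<theta> x * K x \<partial>lborel) = (\<integral>x. \<eta> x * K x + (- s) * (e1 x * K x) + (- t) * (e2 x * K x) \<partial>lborel)"
        by (simp add: algebra_simps)
      also have "\<dots> = k - s * k1 - t * k2"
        using int int1 int2 by (simp add: k_def k1_def k2_def)
      also have "\<dots> = 0" using \<Delta> by (simp add: s_def t_def field_simps) (simp add: \<Delta>_def algebra_simps)
      finally show "(\<integral>x. ?\<theta> x * K x \<partial>lborel) = 0" .
    qed
    moreover have "(\<integral>x. ?\<theta> x * g x \<partial>lborel) = (\<integral>x. \<eta> x * g x + (- s) * (e1 x * g x) + (- t) * (e2 x * g x) \<partial>lborel)"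
      by (simp add: algebra_simps)
    moreover have "\<dots> = (\<integral>x. \<eta> x * g x \<partial>lborel) - s * g1 - t * g2"
      using int int1 int2 by (simp add: g1_def g2_def)
    ultimately have "(\<integral>x. \<eta> x * g x \<partial>lborel) = s * g1 + t * g2" by simp
    also have "\<dots> = \<alpha> * m + \<beta> * k"
      using \<Delta> by (simp add: s_def t_def \<alpha>_def \<beta>_def field_simps)
    finally have "(\<integral>x. \<eta> x * g x - (\<alpha> * \<eta> x + \<beta> * (\<eta> x * K x)) \<partial>lborel) = 0"
      using int by (simp add: m_def k_def)
    then show "(\<integral>x. \<eta> x * (g x - (\<alpha> + \<beta> * K x)) \<partial>lborel) = 0"
      by (simp add: algebra_simps)
  qed
  then have "AE x in lborel. g x = \<alpha> + \<beta> * K x" by simp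
  then show ?thesis by blast
qed


section \<open>Regularity of weak solutions\<close>

lemma ex_antiderivative:
  fixes h :: "real \<Rightarrow> real"
  assumes "continuous_on UNIV h"
  shows "\<exists>F. \<forall>x. (F has_field_derivative h x) (at x)"
proof -
  have "\<exists>F. \<forall>x::real. - \<infinity> < ereal x \<longrightarrow> ereal x < \<infinity> \<longrightarrow> (F has_vector_derivative h x) (at x)"
    using assms by (intro einterval_antiderivative) (auto simp: continuous_on_eq_continuous_at)
  then show ?thesis by (simp add: has_real_derivative_iff_has_vector_derivative)
qed

text \<open>A primitive is constant on each side of the support, and the vanishing integral makes
  the two constants equal; subtracting the common value leaves a function supported in
  \<open>{a..b}\<close>.\<close>

lemma ex_compactly_supported_antiderivative:
  fixes h :: "real \<Rightarrow> real"
  assumes h: "continuous_on UNIV h" and supp: "\<And>x. x \<notin> {a..b} \<Longrightarrow> h x = 0"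
    and 0: "(\<integral>x. h x \<partial>lborel) = 0" and "a \<le> b"
  shows "\<exists>F. (\<forall>x. (F has_field_derivative h x) (at x)) \<and> (\<forall>x. x \<notin> {a..b} \<longrightarrow> F x = 0)"
proof -
  obtain F where F: "\<And>x. (F has_field_derivative h x) (at x)"
    using ex_antiderivative[OF h] by blast
  have "F b - F a = (\<integral>x. indicator {a..b} x *\<^sub>R h x \<partial>lborel)"
  proof (rule integral_FTC_atLeastAtMost[symmetric])
    show "(F has_vector_derivative h x) (at x within {a..b})" for x
      using F by (simp add: has_field_derivative_at_within flip: has_real_derivative_iff_has_vector_derivative)
  qed (use \<open>a \<le> b\<close> h in \<open>auto intro: continuous_on_subset\<close>)
  also have "\<dots> = (\<integral>x. h x \<partial>lborel)"
    using supp by (intro Bochner_Integration.integral_cong) (auto simp: indicator_def)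
  finally have ab: "F b = F a" using 0 by simp
  have "F x = F a" if "x \<notin> {a..b}" for x
  proof (cases "x < a")
    case True
    obtain z where "x < z" "z < a" "F a - F x = (a - x) * h z"
      using MVT2[OF True F] by blast
    then show ?thesis using supp[of z] by simp
  next
    case False
    then have "b < x" using that by auto
    obtain z where "b < z" "z < x" "F x - F b = (x - b) * h z"
      using MVT2[OF \<open>b < x\<close> F] by blast
    then show ?thesis using supp[of z] ab by simp
  qed
  then show ?thesis
    by (intro exI[of _ "\<lambda>x. F x - F a"]) (auto intro!: derivative_eq_intros F)
qed

text \<open>With \<open>V = - ln f\<close> the weighted Laplacian has divergence form,
  \<open>f * \<Delta>\<phi> = (f * \<phi>')'\<close>. The weak equation says
  \<open>- (f * u')' = f * h\<close>, which integrates to \<open>f * u' = c - H\<close>. To prove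
  this, \<open>\<phi>\<close> is found from \<open>\<eta> = (f * \<phi>')'\<close> by integrating
  twice; it has compact support once \<open>\<eta>\<close> has vanishing integrals against
  \<open>1\<close> and \<open>K\<close>, so second-order du Bois-Reymond applies to
  \<open>u + G\<close>.\<close>

lemma weak_solution_regular:
  fixes f u h :: "real \<Rightarrow> real"
  defines "H \<equiv> \<lambda>x. \<integral>y. indicator {..x} y * (f y * h y) \<partial>lborel"
  assumes f: "smooth_real f" "\<And>x. 0 < f x"
    and u: "u \<in> borel_measurable borel" "integrable lborel (\<lambda>x. f x * u x)"
    and h: "integrable lborel (\<lambda>x. f x * h x)"
    and weak: "\<And>\<phi>. \<phi> \<in> test_functions \<Longrightarrow>
      (\<integral>x. f x * (- weighted_laplacian (\<lambda>x. - ln (f x)) \<phi> x * u x) \<partial>lborel) = (\<integral>x. f x * (\<phi> x * h x) \<partial>lborel)"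
  shows "\<exists>v c. (\<forall>x. (v has_field_derivative (c - H x) / f x) (at x)) \<and> (AE x in lborel. u x = v x)"
proof -
  have fc: "continuous_on S f" for S by (rule smooth_real_continuous[OF f(1)])
  have f0: "f x \<noteq> 0" for x using f(2)[of x] by simp
  have Hc: "continuous_on UNIV H"
    unfolding H_def by (auto simp: continuous_on_eq_continuous_at intro!: isCont_integral_Iic h)
  have "continuous_on UNIV (\<lambda>x. 1 / f x)" and "continuous_on UNIV (\<lambda>x. H x / f x)"
    using f0 by (auto intro!: continuous_intros fc Hc)
  then obtain K G where K: "\<And>x. (K has_field_derivative 1 / f x) (at x)"
    and G: "\<And>x. (G has_field_derivative H x / f x) (at x)"
    using ex_antiderivative[of "\<lambda>x. 1 / f x"] ex_antiderivative[of "\<lambda>x. H x / f x"] by blast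
  have Kc: "continuous_on S K" and Gc: "continuous_on S G" for S
    by (rule everywhere_DERIV_continuous_on, rule K G)+
  have uint: "set_integrable lborel {a..b} u" for a b
  proof -
    have "compact ((\<lambda>x. 1 / f x) ` {a..b})"
      using fc f0 by (intro compact_continuous_image continuous_intros) auto
    then have "bounded ((\<lambda>x. 1 / f x) ` {a..b})" by (rule compact_imp_bounded)
    then obtain B where B: "\<And>x. x \<in> {a..b} \<Longrightarrow> \<bar>1 / f x\<bar> \<le> B"
      unfolding bounded_iff by (metis imageI real_norm_def)
    show ?thesis
      unfolding set_integrable_def
    proof (rule Bochner_Integration.integrable_bound)
      show "integrable lborel (\<lambda>x. B * (f x * u x))" using u(2) by simp
      show "(\<lambda>x. indicator {a..b} x *\<^sub>R u x) \<in> borel_measurable lborel" using u(1) by measurable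
      have "\<bar>indicator {a..b} x * u x\<bar> \<le> \<bar>B * (f x * u x)\<bar>" for x
      proof (cases "x \<in> {a..b}")
        case True
        have "\<bar>u x\<bar> = \<bar>1 / f x\<bar> * \<bar>f x * u x\<bar>" using f0 by (simp add: abs_mult)
        also have "\<dots> \<le> \<bar>B\<bar> * \<bar>f x * u x\<bar>" using B[OF True] by (intro mult_right_mono) auto
        finally show ?thesis using True by (simp add: abs_mult)
      qed simp
      then show "AE x in lborel. norm (indicator {a..b} x *\<^sub>R u x) \<le> norm (B * (f x * u x))" by simp
    qed
  qed
  have Gint: "set_integrable lborel {a..b} G" for a b
    by (intro borel_integrable_atLeastAtMost' Gc)
  have Gm: "G \<in> borel_measurable borel" by (intro borel_measurable_continuous_onI Gc)
  have "\<exists>\<alpha> \<beta>. AE x in lborel. u x + G x = \<alpha> + \<beta> * K x"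
  proof (rule du_Bois_Reymond)
    show "(\<lambda>x. u x + G x) \<in> borel_measurable borel" using u(1) Gm by measurable
    show "set_integrable lborel {a..b} (\<lambda>x. u x + G x)" for a b
      using uint Gint by (rule set_integral_add)
    show "continuous_on UNIV K" by (rule Kc)
    have "K x < K y" if "x < y" for x y
      using that by (rule DERIV_pos_imp_increasing) (use K f(2) in \<open>blast intro: divide_pos_pos zero_less_one\<close>)
    then show "mono K" "K 1 < K 2" by (auto simp: mono_def le_less)
    fix \<eta> a0 b0
    assume \<eta>: "smooth_real \<eta>" and supp0: "\<And>x. x \<notin> {a0..b0} \<Longrightarrow> \<eta> x = 0"
      and m0: "(\<integral>x. \<eta> x \<partial>lborel) = 0" and m1: "(\<integral>x. \<eta> x * K x \<partial>lborel) = 0"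
    \<comment> \<open>An ordered interval is needed for the primitives below, and
      \<open>{a0..b0}\<close> may be empty.\<close>
    define a where "a = min a0 b0"
    define b where "b = max a0 b0"
    have "a \<le> b" by (simp add: a_def b_def)
    have supp: "\<eta> x = 0" if "x \<notin> {a..b}" for x
      using that by (intro supp0) (auto simp: a_def b_def)
    have \<eta>c: "continuous_on S \<eta>" for S by (rule smooth_real_continuous[OF \<eta>])
    obtain \<psi> where \<psi>: "\<And>x. (\<psi> has_field_derivative \<eta> x) (at x)" "\<And>x. x \<notin> {a..b} \<Longrightarrow> \<psi> x = 0"
      using ex_compactly_supported_antiderivative[OF \<eta>c supp m0 \<open>a \<le> b\<close>] by blast
    have \<psi>s: "smooth_real \<psi>" using \<psi>(1) \<eta> by (rule smooth_real_antiderivative)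
    have \<psi>f: "smooth_real (\<lambda>x. \<psi> x / f x)" using \<psi>s f(1) f0 by (rule smooth_real_divide)
    \<comment> \<open>The second moment condition becomes the vanishing of the integral of
      \<open>\<psi> / f\<close>, which is what a second compactly supported primitive
      requires.\<close>
    have "(\<integral>x. \<psi> x * (1 / f x) \<partial>lborel) = - (\<integral>x. \<eta> x * K x \<partial>lborel)"
      by (rule integral_by_parts_compact_support[OF \<psi>(1) \<eta>c \<psi>(2) K])
        (auto intro!: continuous_intros fc f0)
    then have "(\<integral>x. \<psi> x / f x \<partial>lborel) = 0" using m1 by simp
    then obtain \<phi> where \<phi>: "\<And>x. (\<phi> has_field_derivative \<psi> x / f x) (at x)" "\<And>x. x \<notin> {a..b} \<Longrightarrow> \<phi> x = 0"
      using ex_compactly_supported_antiderivative[OF smooth_real_continuous[OF \<psi>f] _ _ \<open>a \<le> b\<close>] \<psi>(2)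
      by (metis div_0)
    have "\<phi> \<in> test_functions"
      using smooth_real_antiderivative[OF \<phi>(1) \<psi>f] \<phi>(2) by (rule test_functionsI)
    note weak' = weak[OF this]
    have pointwise: "f x * (- weighted_laplacian (\<lambda>x. - ln (f x)) \<phi> x * u x) = - (\<eta> x * u x)" for x
    proof -
      have f': "(f has_field_derivative deriv f x) (at x)" by (rule smooth_real_DERIV[OF f(1)])
      have d1: "deriv \<phi> = (\<lambda>x. \<psi> x / f x)" using \<phi>(1) by (auto intro: DERIV_imp_deriv)
      have "((\<lambda>x. \<psi> x / f x) has_field_derivative (\<eta> x * f x - \<psi> x * deriv f x) / (f x * f x)) (at x)"
        using DERIV_divide[OF \<psi>(1) f' f0] .
      then have d2: "deriv (\<lambda>x. \<psi> x / f x) x = (\<eta> x * f x - \<psi> x * deriv f x) / (f x * f x)"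
        by (rule DERIV_imp_deriv)
      have "((\<lambda>x. - ln (f x)) has_field_derivative - (deriv f x / f x)) (at x)"
        using f' f(2)[of x] by (auto intro!: derivative_eq_intros)
      then have d3: "deriv (\<lambda>x. - ln (f x)) x = - (deriv f x / f x)" by (rule DERIV_imp_deriv)
      show ?thesis
        unfolding weighted_laplacian_def d1 d2 d3 using f0[of x] by (simp add: field_simps)
    qed
    have "- (\<integral>x. \<eta> x * u x \<partial>lborel) = (\<integral>x. \<phi> x * (f x * h x) \<partial>lborel)"
      using weak' unfolding pointwise by (simp add: mult.left_commute)
    also have "\<dots> = - (\<integral>x. \<psi> x / f x * H x \<partial>lborel)"
      unfolding H_def by (rule integral_by_parts_integrable[OF \<phi>(1) _ \<phi>(2) h]) (rule smooth_real_continuous[OF \<psi>f])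
    also have "(\<integral>x. \<psi> x / f x * H x \<partial>lborel) = (\<integral>x. \<psi> x * (H x / f x) \<partial>lborel)" by simp
    also have "\<dots> = - (\<integral>x. \<eta> x * G x \<partial>lborel)"
      by (rule integral_by_parts_compact_support[OF \<psi>(1) \<eta>c \<psi>(2) G])
        (auto intro!: continuous_intros fc f0 Hc)
    finally have "(\<integral>x. \<eta> x * u x \<partial>lborel) + (\<integral>x. \<eta> x * G x \<partial>lborel) = 0" by simp
    moreover have "integrable lborel (\<lambda>x. \<eta> x * u x)" "integrable lborel (\<lambda>x. \<eta> x * G x)"
      by (rule integrable_mult_compact_support[OF \<eta>c supp] u(1) uint Gm Gint; assumption?)+
    ultimately show "(\<integral>x. \<eta> x * (u x + G x) \<partial>lborel) = 0"
      by (simp add: distrib_left)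
  qed
  then obtain \<alpha> \<beta> where ae: "AE x in lborel. u x + G x = \<alpha> + \<beta> * K x" by blast
  have "((\<lambda>x. \<alpha> + \<beta> * K x - G x) has_field_derivative (\<beta> - H x) / f x) (at x)" for x
    using f0 by (auto intro!: derivative_eq_intros K G simp: diff_divide_distrib)
  moreover have "AE x in lborel. u x = \<alpha> + \<beta> * K x - G x"
    using ae by eventually_elim simp
  ultimately show ?thesis by blast
qed


section \<open>The Dirichlet form\<close>

text \<open>The cutoff is the square of a Lipschitz function, so that its derivative is dominated by its square root.\<close>

definition cutoff_root :: "real \<Rightarrow> real \<Rightarrow> real" where
  "cutoff_root R x = max 0 (1 - (x / R)\<^sup>2)"

definition cutoff' :: "real \<Rightarrow> real \<Rightarrow> real" where
  "cutoff' R x = 2 * cutoff_root R x * (- (2 * x / R\<^sup>2))"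

lemma DERIV_positive_part_square:
  "((\<lambda>y. (max 0 y)\<^sup>2) has_field_derivative 2 * max 0 y) (at (y::real))"
proof -
  consider "y < 0" | "y = 0" | "0 < y" by linarith
  then show ?thesis
  proof cases
    case 1
    have "((\<lambda>_. 0) has_field_derivative 0) (at y)" by simp
    then have "((\<lambda>y. (max 0 y)\<^sup>2) has_field_derivative 0) (at y)"
      by (rule has_field_derivative_transform_within_open[where S = "{..<0}"]) (use 1 in auto)
    with 1 show ?thesis by simp
  next
    case 2
    have "((\<lambda>h. (max 0 h)\<^sup>2 / h) \<longlongrightarrow> 0) (at (0::real))"
    proof (rule Lim_null_comparison)
      show "\<forall>\<^sub>F h::real in at 0. norm ((max 0 h)\<^sup>2 / h) \<le> \<bar>h\<bar>"
        by (intro always_eventually allI) (auto simp: max_def power2_eq_square)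
      show "((\<lambda>h::real. \<bar>h\<bar>) \<longlongrightarrow> 0) (at 0)" by (intro tendsto_rabs_zero tendsto_ident_at)
    qed
    with 2 show ?thesis by (simp add: has_field_derivative_iff)
  next
    case 3
    have "((\<lambda>y. y\<^sup>2) has_field_derivative 2 * y) (at y)" by (auto intro!: derivative_eq_intros)
    then have "((\<lambda>y. (max 0 y)\<^sup>2) has_field_derivative 2 * y) (at y)"
      by (rule has_field_derivative_transform_within_open[where S = "{0<..}"]) (use 3 in auto)
    with 3 show ?thesis by simp
  qed
qed

lemma cutoff_DERIV: "((\<lambda>x. (cutoff_root R x)\<^sup>2) has_field_derivative cutoff' R x) (at x)"
proof -
  have "((\<lambda>x. 1 - (x / R)\<^sup>2) has_field_derivative - (2 * x / R\<^sup>2)) (at x)"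
    by (cases "R = 0") (auto intro!: derivative_eq_intros simp: power2_eq_square)
  from DERIV_chain2[OF DERIV_positive_part_square this] show ?thesis
    by (simp add: cutoff'_def cutoff_root_def)
qed

lemma continuous_cutoff_root: "continuous_on S (cutoff_root R)"
  unfolding cutoff_root_def[abs_def] by (cases "R = 0") (auto intro!: continuous_intros)

lemma continuous_cutoff': "continuous_on S (cutoff' R)"
  unfolding cutoff'_def[abs_def] by (cases "R = 0") (auto intro!: continuous_intros continuous_cutoff_root)

lemma cutoff_root_outside: "0 < R \<Longrightarrow> x \<notin> {- R..R} \<Longrightarrow> cutoff_root R x = 0"
proof -
  assume "0 < R" "x \<notin> {- R..R}"
  then have "1 \<le> \<bar>x / R\<bar>" by (auto simp: abs_le_iff field_simps not_le)
  then have "1 \<le> (x / R)\<^sup>2" using one_le_power[of "\<bar>x / R\<bar>" 2] by (simp del: abs_divide)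
  then show ?thesis by (simp add: cutoff_root_def)
qed

lemma cutoff_root_bounds: "0 \<le> cutoff_root R x" "cutoff_root R x \<le> 1"
  by (simp_all add: cutoff_root_def)

text \<open>On the support \<open>\<bar>x\<bar> \<le> R\<close>, so the explicit factor is at most
  \<open>4 / R\<close>. The surviving factor \<open>cutoff_root\<close> is what lets the cross term
  of the energy estimate be absorbed.\<close>

lemma cutoff'_bound:
  assumes "0 < R"
  shows "\<bar>cutoff' R x\<bar> \<le> 4 / R * cutoff_root R x"
proof (cases "x \<in> {- R..R}")
  case True
  then have "\<bar>x\<bar> \<le> R" by auto
  then have "\<bar>x\<bar> / R\<^sup>2 \<le> R / R\<^sup>2" by (rule divide_right_mono) simp
  then have "4 * cutoff_root R x * (\<bar>x\<bar> / R\<^sup>2) \<le> 4 * cutoff_root R x * (1 / R)"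
    using assms cutoff_root_bounds[of R x] by (intro mult_left_mono) (auto simp: power2_eq_square)
  then show ?thesis
    using cutoff_root_bounds[of R x] by (simp add: cutoff'_def abs_mult)
next
  case False
  then show ?thesis using cutoff_root_outside[OF assms False] by (simp add: cutoff'_def)
qed

lemma cutoff_root_tendsto: "(\<lambda>n. cutoff_root (real (Suc n)) x) \<longlonglongrightarrow> 1"
proof -
  have "(\<lambda>n. max 0 (1 - (x * (1 / real (Suc n)))\<^sup>2)) \<longlonglongrightarrow> max 0 (1 - (x * 0)\<^sup>2)"
    by (intro tendsto_intros LIMSEQ_inverse_real_of_nat[unfolded inverse_eq_divide])
  then show ?thesis by (simp add: cutoff_root_def)
qed

lemma cutoff'_tendsto: "(\<lambda>n. cutoff' (real (Suc n)) x) \<longlonglongrightarrow> 0"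
proof (rule Lim_null_comparison)
  show "\<forall>\<^sub>F n in sequentially. norm (cutoff' (real (Suc n)) x) \<le> 4 * (1 / real (Suc n))"
  proof (intro always_eventually allI)
    fix n
    have "4 / real (Suc n) * cutoff_root (real (Suc n)) x \<le> 4 / real (Suc n) * 1"
      by (intro mult_left_mono cutoff_root_bounds) simp
    then show "norm (cutoff' (real (Suc n)) x) \<le> 4 * (1 / real (Suc n))"
      using cutoff'_bound[of "real (Suc n)" x] by simp
  qed
  have "(\<lambda>n. 4 * (1 / real (Suc n))) \<longlonglongrightarrow> 4 * 0"
    by (intro tendsto_intros LIMSEQ_inverse_real_of_nat[unfolded inverse_eq_divide])
  then show "(\<lambda>n. 4 * (1 / real (Suc n))) \<longlonglongrightarrow> 0" by simp
qed

section \<open>The line with a smooth positive density\<close>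

locale weighted_line = prob_space \<mu> for \<mu> :: "real measure" +
  fixes f :: "real \<Rightarrow> real"
  assumes smooth_density: "smooth_positive_density \<mu> f"
begin

lemma density_smooth: "smooth_real f" and density_pos: "0 < f x"
  and \<mu>_eq: "\<mu> = density lborel (\<lambda>x. ennreal (f x))"
  using smooth_density by (auto simp: smooth_positive_density_def)

lemma density_continuous: "continuous_on S f"
  using density_smooth by (rule smooth_real_continuous)

lemma density_measurable [measurable]: "f \<in> borel_measurable borel"
  by (rule borel_measurable_continuous_onI[OF density_continuous])

lemma sets_\<mu> [simp, measurable_cong]: "sets \<mu> = sets borel"
  by (subst \<mu>_eq) simp

lemma space_\<mu> [simp]: "space \<mu> = UNIV"
  by (subst \<mu>_eq) simp

lemma measurable_\<mu>_iff: "g \<in> borel_measurable \<mu> \<longleftrightarrow> g \<in> borel_measurable borel"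
  by (simp only: measurable_cong_sets[OF sets_\<mu> refl])

lemma AE_\<mu>_iff: "(AE x in \<mu>. P x) \<longleftrightarrow> (AE x in lborel. P x)"
  by (subst \<mu>_eq, subst AE_density) (auto simp: density_pos)

lemma integral_\<mu>:
  fixes g :: "real \<Rightarrow> real"
  assumes "g \<in> borel_measurable borel"
  shows "(\<integral>x. g x \<partial>\<mu>) = (\<integral>x. f x * g x \<partial>lborel)"
  by (subst \<mu>_eq, subst integral_density) (use assms density_pos in \<open>auto intro: less_imp_le\<close>)

lemma integrable_\<mu>:
  fixes g :: "real \<Rightarrow> real"
  assumes "g \<in> borel_measurable borel"
  shows "integrable \<mu> g \<longleftrightarrow> integrable lborel (\<lambda>x. f x * g x)"
  by (subst \<mu>_eq, subst integrable_density) (use assms density_pos in \<open>auto intro: less_imp_le\<close>)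

lemma L2_borel: "g \<in> L2_space \<mu> \<Longrightarrow> g \<in> borel_measurable borel"
  by (simp add: L2_space_def measurable_\<mu>_iff)

lemma L2_integrable: "g \<in> L2_space \<mu> \<Longrightarrow> integrable lborel (\<lambda>x. f x * g x)"
proof -
  assume g: "g \<in> L2_space \<mu>"
  then have "integrable \<mu> g"
    by (rule square_integrable_imp_integrable[OF L2_measurable L2_integrable_square]) (use g in simp_all)
  then show ?thesis by (simp only: integrable_\<mu>[OF L2_borel[OF g]])
qed

lemma integrable_\<mu>_compact_support:
  fixes \<phi> :: "real \<Rightarrow> real"
  assumes "continuous_on UNIV \<phi>" "\<And>x. x \<notin> {a..b} \<Longrightarrow> \<phi> x = 0"
  shows "integrable \<mu> \<phi>"
proof -
  have "integrable lborel (\<lambda>x. f x * \<phi> x)"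
    using assms by (intro integrable_continuous_compact_support[where a = a and b = b] continuous_intros density_continuous) auto
  then show ?thesis
    using borel_measurable_continuous_onI[OF assms(1)] by (simp add: integrable_\<mu>)
qed

text \<open>By construction \<open>f * d = c - H\<close>, where \<open>H\<close> is the primitive of
  \<open>f * h\<close>. The constant \<open>c\<close> drops out because \<open>\<phi>'\<close> has
  integral 0.\<close>

lemma Green_compact_support:
  fixes h :: "real \<Rightarrow> real"
  defines "H \<equiv> \<lambda>x. \<integral>y. indicator {..x} y * (f y * h y) \<partial>lborel"
  assumes h: "h \<in> L2_space \<mu>" and d: "\<And>x. d x = (c - H x) / f x"
    and \<phi>: "\<And>x. (\<phi> has_field_derivative \<phi>' x) (at x)" "continuous_on UNIV \<phi>'"
    and supp: "\<And>x. x \<notin> {a..b} \<Longrightarrow> \<phi> x = 0"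
  shows "(\<integral>x. \<phi> x * h x \<partial>\<mu>) = (\<integral>x. \<phi>' x * d x \<partial>\<mu>)"
proof -
  note hint = L2_integrable[OF h]
  have Hc: "continuous_on UNIV H"
    unfolding H_def by (auto simp: continuous_on_eq_continuous_at intro!: isCont_integral_Iic hint)
  have dc: "continuous_on UNIV d"
    unfolding d[abs_def] using density_pos by (intro continuous_intros Hc density_continuous) (auto simp: less_imp_neq[symmetric])
  have [measurable]: "\<phi> \<in> borel_measurable borel" "\<phi>' \<in> borel_measurable borel" "d \<in> borel_measurable borel" "h \<in> borel_measurable borel"
    using \<phi> dc L2_borel[OF h] by (auto intro!: borel_measurable_continuous_onI everywhere_DERIV_continuous_on)
  note supp' = integral_deriv_compact_support(1)[OF \<phi> supp]
  have int: "integrable lborel (\<lambda>x. \<phi>' x * H x)"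
    using supp' by (intro integrable_continuous_compact_support[where a = a and b = b] continuous_intros \<phi> Hc) auto
  have "(\<integral>x. \<phi> x * h x \<partial>\<mu>) = (\<integral>x. \<phi> x * (f x * h x) \<partial>lborel)"
    by (subst integral_\<mu>) (simp_all add: mult_ac)
  also have "\<dots> = - (\<integral>x. \<phi>' x * H x \<partial>lborel)"
    unfolding H_def by (rule integral_by_parts_integrable[OF \<phi> supp hint])
  also have "\<dots> = (\<integral>x. c * \<phi>' x - \<phi>' x * H x \<partial>lborel)"
    using integral_deriv_compact_support(2,3)[OF \<phi> supp] int by simp
  also have "\<dots> = (\<integral>x. f x * (\<phi>' x * d x) \<partial>lborel)"
    using density_pos by (intro Bochner_Integration.integral_cong) (auto simp: d field_simps less_imp_neq[symmetric])
  also have "\<dots> = (\<integral>x. \<phi>' x * d x \<partial>\<mu>)"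
    by (subst integral_\<mu>) simp_all
  finally show ?thesis .
qed

lemma L2I: "g \<in> borel_measurable borel \<Longrightarrow> integrable \<mu> (\<lambda>x. (g x)\<^sup>2) \<Longrightarrow> g \<in> L2_space \<mu>"
  by (simp add: L2_space_def measurable_\<mu>_iff)

text \<open>A Caccioppoli estimate: testing with \<open>v\<close> times the squared cutoff bounds
  the energy on every interval by one constant, and Fatou makes \<open>d\<close> square-integrable.
  Only then can the cutoff be removed from Green's formula for general \<open>w\<close>, since the
  remainder contains \<open>w * d\<close>.\<close>

lemma energy:
  fixes h :: "real \<Rightarrow> real"
  defines "H \<equiv> \<lambda>x. \<integral>y. indicator {..x} y * (f y * h y) \<partial>lborel"
  assumes h: "h \<in> L2_space \<mu>" and v: "v \<in> L2_space \<mu>"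
    and d: "\<And>x. d x = (c - H x) / f x" and v': "\<And>x. (v has_field_derivative d x) (at x)"
  shows "continuous_on UNIV d" and "d \<in> L2_space \<mu>"
    and "\<And>w w'. (\<And>x. (w has_field_derivative w' x) (at x)) \<Longrightarrow> continuous_on UNIV w' \<Longrightarrow>
      w \<in> L2_space \<mu> \<Longrightarrow> w' \<in> L2_space \<mu> \<Longrightarrow> L2_inner \<mu> d w' = L2_inner \<mu> h w"
proof -
  define \<zeta> where "\<zeta> n = cutoff_root (real (Suc n))" for n
  define \<zeta>' where "\<zeta>' n = cutoff' (real (Suc n))" for n
  have \<zeta>: "0 \<le> \<zeta> n x" "\<zeta> n x \<le> 1" for n x by (simp_all add: \<zeta>_def cutoff_root_bounds)
  have \<zeta>2: "(\<zeta> n x)\<^sup>2 \<le> 1" for n x using \<zeta>[of n x] by (simp add: power_le_one)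
  have \<zeta>'b: "\<bar>\<zeta>' n x\<bar> \<le> 4 * \<zeta> n x" for n x
  proof -
    have "\<bar>\<zeta>' n x\<bar> \<le> 4 / real (Suc n) * \<zeta> n x" unfolding \<zeta>_def \<zeta>'_def by (rule cutoff'_bound) simp
    also have "\<dots> \<le> 4 * \<zeta> n x" using \<zeta>[of n x] by (intro mult_right_mono) (auto simp: field_simps)
    finally show ?thesis .
  qed
  have supp: "\<zeta> n x = 0" if "x \<notin> {- real (Suc n)..real (Suc n)}" for n x
    unfolding \<zeta>_def by (rule cutoff_root_outside[OF _ that]) simp
  have supp': "\<zeta>' n x = 0" if "x \<notin> {- real (Suc n)..real (Suc n)}" for n x
    using \<zeta>'b[of n x] supp[OF that] by simp
  have \<zeta>c: "continuous_on UNIV (\<zeta> n)" "continuous_on UNIV (\<zeta>' n)" for n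
    by (simp_all add: \<zeta>_def \<zeta>'_def continuous_cutoff_root continuous_cutoff')
  have \<zeta>m [measurable]: "\<zeta> n \<in> borel_measurable borel" "\<zeta>' n \<in> borel_measurable borel" for n
    by (intro borel_measurable_continuous_onI \<zeta>c)+
  have \<zeta>_lim: "(\<lambda>n. \<zeta> n x) \<longlonglongrightarrow> 1" "(\<lambda>n. \<zeta>' n x) \<longlonglongrightarrow> 0" for x
    unfolding \<zeta>_def \<zeta>'_def by (rule cutoff_root_tendsto cutoff'_tendsto)+
  have "continuous_on UNIV H"
    unfolding H_def by (auto simp: continuous_on_eq_continuous_at intro!: isCont_integral_Iic L2_integrable h)
  then show dc: "continuous_on UNIV d"
    unfolding d[abs_def] using density_pos by (intro continuous_intros density_continuous) (auto simp: less_imp_neq[symmetric])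
  have vc: "continuous_on UNIV v" by (rule everywhere_DERIV_continuous_on[OF v'])
  have [measurable]: "d \<in> borel_measurable borel" "v \<in> borel_measurable borel" "h \<in> borel_measurable borel"
    using L2_borel[OF h] by (auto intro: borel_measurable_continuous_onI dc vc)
  have green: "(\<integral>x. (\<zeta> n x)\<^sup>2 * w x * h x \<partial>\<mu>) = (\<integral>x. (\<zeta>' n x * w x + (\<zeta> n x)\<^sup>2 * w' x) * d x \<partial>\<mu>)"
    if w: "\<And>x. (w has_field_derivative w' x) (at x)" "continuous_on UNIV w'" for w w' n
  proof (rule Green_compact_support[OF h d[unfolded H_def]])
    show "((\<lambda>x. (\<zeta> n x)\<^sup>2 * w x) has_field_derivative \<zeta>' n x * w x + (\<zeta> n x)\<^sup>2 * w' x) (at x)" for x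
      using DERIV_mult[OF cutoff_DERIV w(1), of "real (Suc n)" x]
      by (simp add: \<zeta>_def \<zeta>'_def mult_ac add_ac)
    show "continuous_on UNIV (\<lambda>x. \<zeta>' n x * w x + (\<zeta> n x)\<^sup>2 * w' x)"
      by (intro continuous_intros \<zeta>c w everywhere_DERIV_continuous_on[OF w(1)])
    show "(\<zeta> n x)\<^sup>2 * w x = 0" if "x \<notin> {- real (Suc n)..real (Suc n)}" for x
      by (simp add: supp[OF that])
  qed
  have vh: "integrable \<mu> (\<lambda>x. v x * h x)" and vv: "integrable \<mu> (\<lambda>x. (v x)\<^sup>2)"
    using h v by (auto intro: L2_integrable_mult L2_integrable_square)
  \<comment> \<open>Absorption will leave half of the cut-off energy on the left, against the
    integral of \<open>\<bar>v * h\<bar>\<close> and 8 times that of \<open>v^2\<close>; doubling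
    gives \<open>C\<close>.\<close>
  define C where "C = 2 * (\<integral>x. \<bar>v x * h x\<bar> \<partial>\<mu>) + 16 * (\<integral>x. (v x)\<^sup>2 \<partial>\<mu>)"
  have int1: "integrable \<mu> (\<lambda>x. (\<zeta> n x)\<^sup>2 * (d x)\<^sup>2)" for n
    by (rule integrable_\<mu>_compact_support[where a = "- real (Suc n)" and b = "real (Suc n)"])
      (auto intro!: continuous_intros \<zeta>c dc simp: supp simp del: atLeastAtMost_iff of_nat_Suc)
  have bound: "(\<integral>x. (\<zeta> n x)\<^sup>2 * (d x)\<^sup>2 \<partial>\<mu>) \<le> C" for n
  proof -
    have int2: "integrable \<mu> (\<lambda>x. (\<zeta>' n x * v x + (\<zeta> n x)\<^sup>2 * d x) * d x)"
      by (rule integrable_\<mu>_compact_support[where a = "- real (Suc n)" and b = "real (Suc n)"])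
        (auto intro!: continuous_intros \<zeta>c dc vc simp: supp supp' simp del: atLeastAtMost_iff of_nat_Suc)
    have "(\<integral>x. (\<zeta> n x)\<^sup>2 * (d x)\<^sup>2 \<partial>\<mu>)
        \<le> (\<integral>x. (\<zeta>' n x * v x + (\<zeta> n x)\<^sup>2 * d x) * d x + (1/2 * ((\<zeta> n x)\<^sup>2 * (d x)\<^sup>2) + 8 * (v x)\<^sup>2) \<partial>\<mu>)"
    proof (rule integral_mono)
      fix x
      have "- (\<zeta>' n x * v x * d x) \<le> \<bar>\<zeta>' n x\<bar> * \<bar>v x\<bar> * \<bar>d x\<bar>"
        by (simp flip: abs_mult)
      also have "\<dots> \<le> (4 * \<zeta> n x) * \<bar>v x\<bar> * \<bar>d x\<bar>"
        using \<zeta>'b[of n x] by (intro mult_right_mono) auto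
      \<comment> \<open>Young's inequality, weighted so that exactly half of the energy term is
        spent.\<close>
      also have "\<dots> \<le> 1/2 * ((\<zeta> n x)\<^sup>2 * (d x)\<^sup>2) + 8 * (v x)\<^sup>2"
        using zero_le_power2[of "\<zeta> n x * \<bar>d x\<bar> - 4 * \<bar>v x\<bar>"]
        by (simp add: power2_eq_square algebra_simps)
      finally show "(\<zeta> n x)\<^sup>2 * (d x)\<^sup>2
          \<le> (\<zeta>' n x * v x + (\<zeta> n x)\<^sup>2 * d x) * d x + (1/2 * ((\<zeta> n x)\<^sup>2 * (d x)\<^sup>2) + 8 * (v x)\<^sup>2)"
        by (simp add: power2_eq_square algebra_simps)
    qed (use int1 int2 vv in auto)
    also have "\<dots> = (\<integral>x. (\<zeta> n x)\<^sup>2 * v x * h x \<partial>\<mu>)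
        + (1/2 * (\<integral>x. (\<zeta> n x)\<^sup>2 * (d x)\<^sup>2 \<partial>\<mu>) + 8 * (\<integral>x. (v x)\<^sup>2 \<partial>\<mu>))"
      unfolding green[OF v' dc] using int1[of n] int2 vv by simp
    also have "(\<integral>x. (\<zeta> n x)\<^sup>2 * v x * h x \<partial>\<mu>) \<le> (\<integral>x. \<bar>v x * h x\<bar> \<partial>\<mu>)"
    proof (rule integral_mono)
      show "integrable \<mu> (\<lambda>x. (\<zeta> n x)\<^sup>2 * v x * h x)"
      proof (rule Bochner_Integration.integrable_bound[OF vh])
        show "AE x in \<mu>. norm ((\<zeta> n x)\<^sup>2 * v x * h x) \<le> norm (v x * h x)"
          using mult_right_mono[OF \<zeta>2, of "\<bar>v _ * h _\<bar>"] by (auto simp: abs_mult mult_ac)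
      qed simp
      show "(\<zeta> n x)\<^sup>2 * v x * h x \<le> \<bar>v x * h x\<bar>" for x
        using mult_right_mono[OF \<zeta>2[of n x], of "\<bar>v x * h x\<bar>"] abs_ge_self[of "(\<zeta> n x)\<^sup>2 * (v x * h x)"]
        by (simp add: abs_mult mult.assoc)
    qed (use vh in simp)
    finally show ?thesis by (simp add: C_def)
  qed
  \<comment> \<open>Fatou's lemma: the cutoffs tend to 1 pointwise and \<open>C\<close> is
    independent of \<open>n\<close>.\<close>
  have "(\<integral>\<^sup>+x. ennreal ((d x)\<^sup>2) \<partial>\<mu>) = (\<integral>\<^sup>+x. liminf (\<lambda>n. ennreal ((\<zeta> n x)\<^sup>2 * (d x)\<^sup>2)) \<partial>\<mu>)"
  proof (rule nn_integral_cong)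
    fix x
    have "(\<lambda>n. ennreal ((\<zeta> n x)\<^sup>2 * (d x)\<^sup>2)) \<longlonglongrightarrow> ennreal (1\<^sup>2 * (d x)\<^sup>2)"
      by (intro tendsto_ennrealI tendsto_intros \<zeta>_lim)
    from lim_imp_Liminf[OF _ this]
    show "ennreal ((d x)\<^sup>2) = liminf (\<lambda>n. ennreal ((\<zeta> n x)\<^sup>2 * (d x)\<^sup>2))" by simp
  qed
  also have "\<dots> \<le> liminf (\<lambda>n. \<integral>\<^sup>+x. ennreal ((\<zeta> n x)\<^sup>2 * (d x)\<^sup>2) \<partial>\<mu>)"
    by (rule nn_integral_liminf) simp
  also have "\<dots> \<le> liminf (\<lambda>n. ennreal C)"
  proof (rule Liminf_mono, rule always_eventually, rule allI)
    fix n
    have "(\<integral>\<^sup>+x. ennreal ((\<zeta> n x)\<^sup>2 * (d x)\<^sup>2) \<partial>\<mu>) = ennreal (\<integral>x. (\<zeta> n x)\<^sup>2 * (d x)\<^sup>2 \<partial>\<mu>)"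
      by (rule nn_integral_eq_integral[OF int1]) simp
    then show "(\<integral>\<^sup>+x. ennreal ((\<zeta> n x)\<^sup>2 * (d x)\<^sup>2) \<partial>\<mu>) \<le> ennreal C"
      using bound[of n] by (simp add: ennreal_leI)
  qed
  also have "\<dots> = ennreal C" by (simp add: Liminf_const)
  finally have "(\<integral>\<^sup>+x. ennreal ((d x)\<^sup>2) \<partial>\<mu>) < \<infinity>"
    by (rule le_less_trans) simp
  then have "integrable \<mu> (\<lambda>x. (d x)\<^sup>2)" by (simp add: integrable_iff_bounded)
  then show dL: "d \<in> L2_space \<mu>" by (intro L2I) simp_all
  fix w w' assume w: "\<And>x. (w has_field_derivative w' x) (at x)" "continuous_on UNIV w'"
    and wL: "w \<in> L2_space \<mu>" and w'L: "w' \<in> L2_space \<mu>"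
  note [measurable] = L2_borel[OF wL] L2_borel[OF w'L]
  have "(\<lambda>n. \<integral>x. (\<zeta> n x)\<^sup>2 * w x * h x \<partial>\<mu>) \<longlonglongrightarrow> (\<integral>x. w x * h x \<partial>\<mu>)"
  proof (rule integral_dominated_convergence[where w = "\<lambda>x. \<bar>w x * h x\<bar>"])
    show "AE x in \<mu>. (\<lambda>n. (\<zeta> n x)\<^sup>2 * w x * h x) \<longlonglongrightarrow> w x * h x"
    proof (rule AE_I2)
      fix x
      have "(\<lambda>n. (\<zeta> n x)\<^sup>2 * w x * h x) \<longlonglongrightarrow> 1\<^sup>2 * w x * h x" by (intro tendsto_intros \<zeta>_lim)
      then show "(\<lambda>n. (\<zeta> n x)\<^sup>2 * w x * h x) \<longlonglongrightarrow> w x * h x" by simp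
    qed
    show "AE x in \<mu>. norm ((\<zeta> n x)\<^sup>2 * w x * h x) \<le> \<bar>w x * h x\<bar>" for n
      using mult_right_mono[OF \<zeta>2, of "\<bar>w _ * h _\<bar>"] by (auto simp: abs_mult mult_ac)
  qed (use L2_integrable_mult[OF wL h] in auto)
  \<comment> \<open>The dominating function is integrable because \<open>d\<close> is now in
    \<open>L2_space \<mu>\<close>; the term with \<open>\<zeta>'\<close> is the boundary
    contribution and tends to 0.\<close>
  moreover have "(\<lambda>n. \<integral>x. (\<zeta>' n x * w x + (\<zeta> n x)\<^sup>2 * w' x) * d x \<partial>\<mu>) \<longlonglongrightarrow> (\<integral>x. w' x * d x \<partial>\<mu>)"
  proof (rule integral_dominated_convergence[where w = "\<lambda>x. 4 * \<bar>w x * d x\<bar> + \<bar>w' x * d x\<bar>"])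
    show "AE x in \<mu>. (\<lambda>n. (\<zeta>' n x * w x + (\<zeta> n x)\<^sup>2 * w' x) * d x) \<longlonglongrightarrow> w' x * d x"
    proof (rule AE_I2)
      fix x
      have "(\<lambda>n. (\<zeta>' n x * w x + (\<zeta> n x)\<^sup>2 * w' x) * d x) \<longlonglongrightarrow> (0 * w x + 1\<^sup>2 * w' x) * d x"
        by (intro tendsto_intros \<zeta>_lim)
      then show "(\<lambda>n. (\<zeta>' n x * w x + (\<zeta> n x)\<^sup>2 * w' x) * d x) \<longlonglongrightarrow> w' x * d x" by simp
    qed
    show "AE x in \<mu>. norm ((\<zeta>' n x * w x + (\<zeta> n x)\<^sup>2 * w' x) * d x) \<le> 4 * \<bar>w x * d x\<bar> + \<bar>w' x * d x\<bar>" for n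
    proof (rule AE_I2)
      fix x
      have "\<bar>(\<zeta>' n x * w x + (\<zeta> n x)\<^sup>2 * w' x) * d x\<bar> \<le> \<bar>\<zeta>' n x\<bar> * \<bar>w x * d x\<bar> + (\<zeta> n x)\<^sup>2 * \<bar>w' x * d x\<bar>"
        using abs_triangle_ineq[of "\<zeta>' n x * (w x * d x)" "(\<zeta> n x)\<^sup>2 * (w' x * d x)"]
        by (simp add: abs_mult algebra_simps)
      also have "\<dots> \<le> 4 * \<bar>w x * d x\<bar> + 1 * \<bar>w' x * d x\<bar>"
        using \<zeta>'b[of n x] \<zeta>[of n x] by (intro add_mono mult_right_mono \<zeta>2) auto
      finally show "norm ((\<zeta>' n x * w x + (\<zeta> n x)\<^sup>2 * w' x) * d x) \<le> 4 * \<bar>w x * d x\<bar> + \<bar>w' x * d x\<bar>" by simp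
    qed
  qed (use L2_integrable_mult[OF wL dL] L2_integrable_mult[OF w'L dL] in auto)
  ultimately have "(\<integral>x. w x * h x \<partial>\<mu>) = (\<integral>x. w' x * d x \<partial>\<mu>)"
    unfolding green[OF w] by (rule LIMSEQ_unique)
  then show "L2_inner \<mu> d w' = L2_inner \<mu> h w"
    by (simp add: L2_inner_def mult.commute)
qed

text \<open>Every self-adjoint extension of the Laplacian on test functions is contained in the adjoint, so its
  domain consists of weak solutions; the completeness of the line (in the guise of the cutoffs) excludes
  boundary terms.\<close>

theorem self_adjoint_laplacian_form:
  assumes A: "self_adjoint_laplacian \<mu> f A" and uh: "(u, h) \<in> A"
  obtains v d where "\<And>x. (v has_field_derivative d x) (at x)" "continuous_on UNIV d"
    "v \<in> L2_space \<mu>" "d \<in> L2_space \<mu>" "AE x in \<mu>. u x = v x"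
    "\<And>w w'. (\<And>x. (w has_field_derivative w' x) (at x)) \<Longrightarrow> continuous_on UNIV w' \<Longrightarrow>
      w \<in> L2_space \<mu> \<Longrightarrow> w' \<in> L2_space \<mu> \<Longrightarrow> L2_inner \<mu> d w' = L2_inner \<mu> h w"
proof -
  have adj: "L2_adjoint \<mu> A = A" and ext: "neg_laplacian_graph (\<lambda>x. - ln (f x)) \<subseteq> A"
    using A by (auto simp: self_adjoint_laplacian_def L2_self_adjoint_def)
  have "(u, h) \<in> L2_adjoint \<mu> A" using uh by (simp only: adj)
  then have u: "u \<in> L2_space \<mu>" and h: "h \<in> L2_space \<mu>"
    and weak: "\<And>\<phi> g. (\<phi>, g) \<in> A \<Longrightarrow> L2_inner \<mu> g u = L2_inner \<mu> \<phi> h"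
    by (auto simp: L2_adjoint_def)
  have AL2: "\<phi> \<in> L2_space \<mu> \<and> g \<in> L2_space \<mu>" if "(\<phi>, g) \<in> A" for \<phi> g
    using that by (subst (asm) adj[symmetric]) (auto simp: L2_adjoint_def)
  have "\<exists>v c. (\<forall>x. (v has_field_derivative (c - (\<integral>y. indicator {..x} y * (f y * h y) \<partial>lborel)) / f x) (at x))
      \<and> (AE x in lborel. u x = v x)"
  proof (rule weak_solution_regular[OF density_smooth density_pos L2_borel[OF u] L2_integrable[OF u] L2_integrable[OF h]])
    fix \<phi> assume "\<phi> \<in> test_functions"
    define g where "g = (\<lambda>x. - weighted_laplacian (\<lambda>x. - ln (f x)) \<phi> x)"
    have "(\<phi>, g) \<in> A" using \<open>\<phi> \<in> test_functions\<close> ext by (auto simp: neg_laplacian_graph_def g_def)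
    note weak[OF this]
    moreover have "\<phi> \<in> borel_measurable borel" "g \<in> borel_measurable borel"
      using AL2[OF \<open>(\<phi>, g) \<in> A\<close>] by (auto intro: L2_borel)
    ultimately have "(\<integral>x. f x * (g x * u x) \<partial>lborel) = (\<integral>x. f x * (\<phi> x * h x) \<partial>lborel)"
      using L2_borel[OF u] L2_borel[OF h] by (simp add: L2_inner_def integral_\<mu>)
    then show "(\<integral>x. f x * (- weighted_laplacian (\<lambda>x. - ln (f x)) \<phi> x * u x) \<partial>lborel) = (\<integral>x. f x * (\<phi> x * h x) \<partial>lborel)"
      by (simp add: g_def)
  qed
  then obtain v c where v: "\<And>x. (v has_field_derivative (c - (\<integral>y. indicator {..x} y * (f y * h y) \<partial>lborel)) / f x) (at x)"
    and ae: "AE x in lborel. u x = v x" by blast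
  define d where "d x = (c - (\<integral>y. indicator {..x} y * (f y * h y) \<partial>lborel)) / f x" for x
  have v': "(v has_field_derivative d x) (at x)" for x using v by (simp add: d_def)
  have ae': "AE x in \<mu>. u x = v x" using ae by (simp add: AE_\<mu>_iff)
  have vL: "v \<in> L2_space \<mu>"
    using borel_measurable_continuous_onI[OF everywhere_DERIV_continuous_on[OF v']]
    by (intro L2_cong_AE[OF u _ ae']) (simp add: measurable_\<mu>_iff)
  note en = energy[OF h vL d_def v']
  show ?thesis by (rule that[OF v' en(1) vL en(2) ae' en(3)])
qed

end


section \<open>Rayleigh quotients\<close>

locale laplacian_line =
  weighted_line \<mu> f + spectral_operator \<mu> A E
  for \<mu> :: "real measure" and f A E +
  assumes laplacian: "self_adjoint_laplacian \<mu> f A"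
begin

text \<open>Green's formula with the C^1 representative tested against itself shows that the form is
  the energy.\<close>

lemma A_nonneg:
  assumes "(u, h) \<in> A"
  shows "0 \<le> L2_inner \<mu> u h"
proof -
  obtain v d where v: "\<And>x. (v has_field_derivative d x) (at x)" "continuous_on UNIV d"
    "v \<in> L2_space \<mu>" "d \<in> L2_space \<mu>" "AE x in \<mu>. u x = v x"
    and form: "\<And>w w'. (\<And>x. (w has_field_derivative w' x) (at x)) \<Longrightarrow> continuous_on UNIV w' \<Longrightarrow>
      w \<in> L2_space \<mu> \<Longrightarrow> w' \<in> L2_space \<mu> \<Longrightarrow> L2_inner \<mu> d w' = L2_inner \<mu> h w"
    using self_adjoint_laplacian_form[OF laplacian assms] by blast
  have "L2_inner \<mu> u h = L2_inner \<mu> v h"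
    using v A_L2[OF assms] by (intro L2_inner_cong_AE) (auto intro: L2_measurable)
  also have "\<dots> = L2_inner \<mu> d d"
    using form[OF v(1-4)] by (simp add: L2_inner_commute)
  finally show ?thesis by (simp add: L2_inner_self_nonneg)
qed

lemma energy_le_on_spectral_subspace:
  assumes u: "u \<in> L2_space \<mu>" and Eu: "AE x in \<mu>. E s u x = u x"
  obtains v d where "\<And>x. (v has_field_derivative d x) (at x)" "continuous_on UNIV d"
    "v \<in> L2_space \<mu>" "d \<in> L2_space \<mu>" "AE x in \<mu>. u x = v x"
    "L2_inner \<mu> d d \<le> s * L2_inner \<mu> v v"
proof -
  \<comment> \<open>Any negative level would do: there is no spectrum below 0, and some lower bound
    is needed to apply \<open>bounded_spectrum\<close>.\<close>
  have "AE x in \<mu>. E (- 1) u x = 0"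
    by (rule nonneg_imp_E_eq_0[OF A_nonneg u]) auto
  note spectrum = bounded_spectrum[OF u this Eu]
  obtain h where h: "(u, h) \<in> A" using spectrum(1) by auto
  obtain v d where v: "\<And>x. (v has_field_derivative d x) (at x)" "continuous_on UNIV d"
    "v \<in> L2_space \<mu>" "d \<in> L2_space \<mu>" "AE x in \<mu>. u x = v x"
    and form: "\<And>w w'. (\<And>x. (w has_field_derivative w' x) (at x)) \<Longrightarrow> continuous_on UNIV w' \<Longrightarrow>
      w \<in> L2_space \<mu> \<Longrightarrow> w' \<in> L2_space \<mu> \<Longrightarrow> L2_inner \<mu> d w' = L2_inner \<mu> h w"
    using self_adjoint_laplacian_form[OF laplacian h] by blast
  have "L2_inner \<mu> d d = L2_inner \<mu> v h"
    using form[OF v(1-4)] by (simp add: L2_inner_commute)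
  also have "\<dots> = L2_inner \<mu> u h"
    using v A_L2[OF h] by (intro L2_inner_cong_AE) (auto intro: L2_measurable)
  also have "\<dots> \<le> s * L2_inner \<mu> u u" by (rule spectrum(3)[OF h])
  also have "L2_inner \<mu> u u = L2_inner \<mu> v v"
    using v u by (intro L2_inner_cong_AE) (auto intro: L2_measurable)
  finally show ?thesis using that v by blast
qed

text \<open>With \<open>v = E b w\<close> and \<open>q = \<langle>v, A v\<rangle> = \<integral> (v')\<^sup>2\<close> one has \<open>q = \<langle>w, A v\<rangle> = \<integral> w' v'\<close>, hence \<open>q \<le> \<integral> (w')\<^sup>2\<close> by
  Cauchy--Schwarz.\<close>

lemma energy_ge_on_orthogonal_complement:
  assumes w: "\<And>x. (w has_field_derivative w' x) (at x)" "continuous_on UNIV w'"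
    "w \<in> L2_space \<mu>" "w' \<in> L2_space \<mu>" and low: "AE x in \<mu>. E t w x = 0"
  shows "t * L2_inner \<mu> w w \<le> L2_inner \<mu> w' w'"
proof -
  have le: "t * distribution w b \<le> L2_inner \<mu> w' w'" for b
  proof -
    have Eb: "E b w \<in> L2_space \<mu>" using w(3) by simp
    note spectrum = bounded_spectrum[OF Eb E_bounded_spectrum[OF w(3) low]]
    obtain h where h: "(E b w, h) \<in> A" using spectrum(1) by auto
    obtain v d where v: "\<And>x. (v has_field_derivative d x) (at x)" "continuous_on UNIV d"
      "v \<in> L2_space \<mu>" "d \<in> L2_space \<mu>" "AE x in \<mu>. E b w x = v x"
      and form: "\<And>w w'. (\<And>x. (w has_field_derivative w' x) (at x)) \<Longrightarrow> continuous_on UNIV w' \<Longrightarrow>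
        w \<in> L2_space \<mu> \<Longrightarrow> w' \<in> L2_space \<mu> \<Longrightarrow> L2_inner \<mu> d w' = L2_inner \<mu> h w"
      using self_adjoint_laplacian_form[OF laplacian h] by blast
    define q where "q = L2_inner \<mu> d d"
    have q: "q = L2_inner \<mu> (E b w) h"
    proof -
      have "q = L2_inner \<mu> v h" unfolding q_def using form[OF v(1-4)] by (simp add: L2_inner_commute)
      also have "\<dots> = L2_inner \<mu> (E b w) h"
        using v A_L2[OF h] by (intro L2_inner_cong_AE) (auto intro: L2_measurable)
      finally show ?thesis .
    qed
    have "L2_inner \<mu> d w' = L2_inner \<mu> w h"
      using form[OF w] by (simp add: L2_inner_commute)
    also have "\<dots> = q" unfolding q by (rule A_spectral_orthogonal[OF w(3) low h])
    finally have "q\<^sup>2 \<le> q * L2_inner \<mu> w' w'"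
      using L2_Cauchy_Schwarz[OF v(4) w(4)] by (simp add: q_def)
    moreover have "0 \<le> q" by (simp add: q_def L2_inner_self_nonneg)
    ultimately have "q \<le> L2_inner \<mu> w' w'"
      using L2_inner_self_nonneg[of \<mu> w'] by (cases "q = 0") (auto simp: power2_eq_square)
    moreover have "t * distribution w b \<le> q"
      unfolding q distribution_eq[OF w(3)] by (rule spectrum(2)[OF h])
    ultimately show ?thesis by simp
  qed
  \<comment> \<open>The bound for the truncations is uniform in \<open>b\<close>, and
    \<open>distribution w b\<close> tends to the squared norm of \<open>w\<close>.\<close>
  have "((\<lambda>b. t * distribution w b) \<longlongrightarrow> t * L2_inner \<mu> w w) at_top"
    by (intro tendsto_intros distribution_at_top w)
  then show ?thesis by (rule tendsto_upperbound) (auto simp: le)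
qed

end


section \<open>Monotone transport\<close>

context weighted_line
begin

sublocale real_distribution \<mu>
  by unfold_locales simp

lemma cdf_DERIV: "(cdf \<mu> has_field_derivative f x) (at x)"
proof -
  obtain F where F: "\<And>x. (F has_field_derivative f x) (at x)"
    using ex_antiderivative[OF density_continuous] by blast
  have less: "cdf \<mu> b - cdf \<mu> a = F b - F a" if "a < b" for a b
  proof -
    have "cdf \<mu> b - cdf \<mu> a = (\<integral>x. indicator {a<..b} x \<partial>\<mu>)"
      using cdf_diff_eq[OF that] by simp
    also have "\<dots> = (\<integral>x. f x * indicator {a<..b} x \<partial>lborel)" by (rule integral_\<mu>) simp
    also have "\<dots> = (\<integral>x. indicator {a..b} x *\<^sub>R f x \<partial>lborel)"
    proof (rule integral_cong_AE)
      show "AE x in lborel. f x * indicator {a<..b} x = indicator {a..b} x *\<^sub>R f x"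
        using AE_lborel_singleton[of a] by eventually_elim (auto simp: indicator_def)
    qed measurable
    also have "\<dots> = F b - F a"
    proof (rule integral_FTC_atLeastAtMost)
      show "(F has_vector_derivative f x) (at x within {a..b})" for x
        using F by (simp add: has_field_derivative_at_within flip: has_real_derivative_iff_has_vector_derivative)
    qed (use that density_continuous in auto)
    finally show ?thesis .
  qed
  have "cdf \<mu> x = F x + (cdf \<mu> 0 - F 0)" for x
    using less[of 0 x] less[of x 0] by (cases x "0::real" rule: linorder_cases) auto
  then have "cdf \<mu> = (\<lambda>x. F x + (cdf \<mu> 0 - F 0))" by (rule ext)
  moreover have "((\<lambda>x. F x + (cdf \<mu> 0 - F 0)) has_field_derivative f x) (at x)"
    using F by (auto intro!: derivative_eq_intros)
  ultimately show ?thesis by simp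
qed

lemma cdf_less_iff: "cdf \<mu> x < cdf \<mu> y \<longleftrightarrow> x < y"
proof -
  have "cdf \<mu> x < cdf \<mu> y" if "x < y" for x y
    using that by (rule DERIV_pos_imp_increasing) (use cdf_DERIV density_pos in blast)
  then show ?thesis by (metis less_asym linorder_cases)
qed

lemma cdf_le_iff: "cdf \<mu> x \<le> cdf \<mu> y \<longleftrightarrow> x \<le> y"
  using cdf_less_iff[of y x] by (simp flip: not_less)

lemma inj_cdf: "inj (cdf \<mu>)"
  by (rule injI) (metis cdf_less_iff less_irrefl linorder_cases)

lemma range_cdf: "range (cdf \<mu>) = {0<..<1}"
proof (intro equalityI subsetI)
  fix v assume "v \<in> range (cdf \<mu>)"
  then obtain x where v: "v = cdf \<mu> x" by auto
  have "cdf \<mu> (x - 1) < cdf \<mu> x" "cdf \<mu> x < cdf \<mu> (x + 1)" by (simp_all add: cdf_less_iff)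
  then show "v \<in> {0<..<1}"
    unfolding v using cdf_nonneg[of "x - 1"] cdf_bounded_prob[of "x + 1"] by simp
next
  fix v :: real assume v: "v \<in> {0<..<1}"
  have "\<exists>a. cdf \<mu> a < v"
    using order_tendstoD(2)[OF cdf_lim_at_bot, of v] v by (auto dest: eventually_happens)
  moreover have "\<exists>b. v < cdf \<mu> b"
    using order_tendstoD(1)[OF cdf_lim_at_top_prob, of v] v by (auto dest: eventually_happens)
  ultimately obtain a b where ab: "cdf \<mu> a < v" "v < cdf \<mu> b" by blast
  then have "a < b" using cdf_less_iff[of a b] by simp
  then obtain x where "cdf \<mu> x = v"
    using IVT'[of "cdf \<mu>" a v b] ab everywhere_DERIV_continuous_on[OF cdf_DERIV] by auto
  then show "v \<in> range (cdf \<mu>)" by blast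
qed

lemma inv_cdf_cdf [simp]: "inv (cdf \<mu>) (cdf \<mu> x) = x"
  using inj_cdf by simp

lemma cdf_inv_cdf: "v \<in> {0<..<1} \<Longrightarrow> cdf \<mu> (inv (cdf \<mu>) v) = v"
  by (simp add: f_inv_into_f range_cdf)

lemma cdf_in: "cdf \<mu> x \<in> {0<..<1}"
  using range_cdf by auto

text \<open>Values of the cdf avoid 0 and 1, so the endpoint convention of the profile never
  intervenes.\<close>

lemma flat_profile_cdf: "flat_profile \<mu> f (cdf \<mu> x) = f x"
  using cdf_in[of x] by (simp add: flat_profile_def)

lemma inv_cdf_DERIV:
  assumes "v \<in> {0<..<1}"
  shows "(inv (cdf \<mu>) has_field_derivative inverse (f (inv (cdf \<mu>) v))) (at v)"
proof (rule DERIV_inverse_function[where f = "cdf \<mu>" and a = 0 and b = 1])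
  show "(cdf \<mu> has_field_derivative f (inv (cdf \<mu>) v)) (at (inv (cdf \<mu>) v))" by (rule cdf_DERIV)
  show "f (inv (cdf \<mu>) v) \<noteq> 0" using density_pos[of "inv (cdf \<mu>) v"] by simp
  have "isCont (inv (cdf \<mu>)) (cdf \<mu> (inv (cdf \<mu>) v))"
    by (rule isCont_inverse_function[where d = 1]) (auto intro: DERIV_isCont[OF cdf_DERIV])
  then show "isCont (inv (cdf \<mu>)) v" by (simp add: cdf_inv_cdf[OF assms])
qed (use assms in \<open>auto intro: cdf_inv_cdf\<close>)

end

section \<open>The transport map between the two weighted lines\<close>

locale transport = \<mu>1: weighted_line \<mu>1 f1 + \<mu>2: weighted_line \<mu>2 f2
  for \<mu>1 f1 \<mu>2 f2
begin

definition T :: "real \<Rightarrow> real" where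
  "T x = inv (cdf \<mu>2) (cdf \<mu>1 x)"

lemma T_DERIV: "(T has_field_derivative f1 x / f2 (T x)) (at x)"
proof -
  have "((\<lambda>x. inv (cdf \<mu>2) (cdf \<mu>1 x)) has_field_derivative inverse (f2 (inv (cdf \<mu>2) (cdf \<mu>1 x))) * f1 x) (at x)"
    by (rule DERIV_chain2[OF \<mu>2.inv_cdf_DERIV[OF \<mu>1.cdf_in] \<mu>1.cdf_DERIV])
  moreover have "T = (\<lambda>x. inv (cdf \<mu>2) (cdf \<mu>1 x))" by (auto simp: T_def)
  ultimately show ?thesis by (simp add: divide_inverse mult.commute)
qed

lemma T_continuous: "continuous_on S T"
  by (rule everywhere_DERIV_continuous_on[OF T_DERIV])

lemma T_measurable [measurable]: "T \<in> borel_measurable borel"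
  by (intro borel_measurable_continuous_onI T_continuous)

text \<open>Preimages of half-lines are half-lines with explicit endpoint, which is the form needed
  to compute the cdf of the pushforward.\<close>

lemma T_le_iff: "T x \<le> y \<longleftrightarrow> x \<le> inv (cdf \<mu>1) (cdf \<mu>2 y)"
proof -
  have "T x \<le> y \<longleftrightarrow> cdf \<mu>2 (T x) \<le> cdf \<mu>2 y" by (simp add: \<mu>2.cdf_le_iff)
  also have "\<dots> \<longleftrightarrow> cdf \<mu>1 x \<le> cdf \<mu>1 (inv (cdf \<mu>1) (cdf \<mu>2 y))"
    by (simp add: T_def \<mu>2.cdf_inv_cdf[OF \<mu>1.cdf_in] \<mu>1.cdf_inv_cdf[OF \<mu>2.cdf_in])
  finally show ?thesis by (simp add: \<mu>1.cdf_le_iff)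
qed

lemma distr_T: "distr \<mu>1 borel T = \<mu>2"
proof (rule cdf_unique)
  have T: "T \<in> borel_measurable \<mu>1" by measurable
  show "real_distribution (distr \<mu>1 borel T)" using T by (rule \<mu>1.real_distribution_distr)
  show "real_distribution \<mu>2" by unfold_locales
  show "cdf (distr \<mu>1 borel T) = cdf \<mu>2"
  proof
    fix y
    have "cdf (distr \<mu>1 borel T) y = measure \<mu>1 (T -` {..y} \<inter> space \<mu>1)"
      unfolding cdf_def by (rule measure_distr[OF T]) simp
    also have "T -` {..y} \<inter> space \<mu>1 = {..inv (cdf \<mu>1) (cdf \<mu>2 y)}"
      by (auto simp: T_le_iff)
    also have "measure \<mu>1 \<dots> = cdf \<mu>2 y"
      using \<mu>1.cdf_inv_cdf[OF \<mu>2.cdf_in[of y]] by (simp add: cdf_def)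
    finally show "cdf (distr \<mu>1 borel T) y = cdf \<mu>2 y" .
  qed
qed

lemma AE_T:
  assumes "AE y in \<mu>2. P y"
  shows "AE x in \<mu>1. P (T x)"
proof (rule AE_distrD[of T \<mu>1 borel])
  show "T \<in> measurable \<mu>1 borel" by measurable
  show "AE y in distr \<mu>1 borel T. P y" unfolding distr_T by (rule assms)
qed

lemma integral_T:
  fixes g :: "real \<Rightarrow> real"
  assumes "g \<in> borel_measurable borel"
  shows "(\<integral>x. g (T x) \<partial>\<mu>1) = (\<integral>y. g y \<partial>\<mu>2)"
  using integral_distr[of T \<mu>1 borel g] assms by (simp add: distr_T)

lemma integrable_T:
  fixes g :: "real \<Rightarrow> real"
  assumes "g \<in> borel_measurable borel"
  shows "integrable \<mu>1 (\<lambda>x. g (T x)) \<longleftrightarrow> integrable \<mu>2 g"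
  using integrable_distr_eq[of T \<mu>1 borel g] assms by (simp add: distr_T)

lemma L2_T:
  assumes g: "g \<in> L2_space \<mu>2"
  shows "(\<lambda>x. g (T x)) \<in> L2_space \<mu>1"
proof (rule \<mu>1.L2I)
  note [measurable] = \<mu>2.L2_borel[OF g]
  show "(\<lambda>x. g (T x)) \<in> borel_measurable borel" by measurable
  show "integrable \<mu>1 (\<lambda>x. (g (T x))\<^sup>2)"
    using L2_integrable_square[OF g] by (subst integrable_T[of "\<lambda>y. (g y)\<^sup>2"]) simp_all
qed

lemma L2_inner_T:
  assumes g: "g \<in> L2_space \<mu>2"
  shows "L2_inner \<mu>1 (\<lambda>x. g (T x)) (\<lambda>x. g (T x)) = L2_inner \<mu>2 g g"
  unfolding L2_inner_def using \<mu>2.L2_borel[OF g] by (subst integral_T[of "\<lambda>y. g y * g y"]) simp_all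

text \<open>The square of the derivative of the pullback is at most \<open>L^2\<close> times
  \<open>d^2\<close> evaluated at \<open>T x\<close>, and integrals of functions of \<open>T\<close>
  against \<open>\<mu>1\<close> are integrals against \<open>\<mu>2\<close>. The profiles are
  compared at \<open>cdf \<mu>1 x\<close>, which is also \<open>cdf \<mu>2 (T x)\<close>.\<close>

lemma energy_T:
  assumes v: "\<And>x. (v has_field_derivative d x) (at x)" "continuous_on UNIV d" "d \<in> L2_space \<mu>2"
    and L: "L > 0" "\<And>v. v \<in> {0<..<1} \<Longrightarrow> 1 / L * flat_profile \<mu>1 f1 v \<le> flat_profile \<mu>2 f2 v"
  obtains w' where "\<And>x. ((\<lambda>x. v (T x)) has_field_derivative w' x) (at x)" "continuous_on UNIV w'"
    "w' \<in> L2_space \<mu>1" "L2_inner \<mu>1 w' w' \<le> L\<^sup>2 * L2_inner \<mu>2 d d"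
proof
  define w' where "w' x = d (T x) * (f1 x / f2 (T x))" for x
  have nz: "f2 x \<noteq> 0" for x using \<mu>2.density_pos[of x] by simp
  have T': "0 \<le> f1 x / f2 (T x)" "f1 x / f2 (T x) \<le> L" for x
  proof -
    have "1 / L * f1 x \<le> flat_profile \<mu>2 f2 (cdf \<mu>1 x)"
      using L(2)[OF \<mu>1.cdf_in[of x]] by (simp add: \<mu>1.flat_profile_cdf)
    also have "cdf \<mu>1 x = cdf \<mu>2 (T x)" by (simp add: T_def \<mu>2.cdf_inv_cdf[OF \<mu>1.cdf_in])
    finally show "f1 x / f2 (T x) \<le> L"
      using L(1) \<mu>2.density_pos[of "T x"] by (simp add: \<mu>2.flat_profile_cdf field_simps)
    show "0 \<le> f1 x / f2 (T x)"
      using \<mu>1.density_pos[of x] \<mu>2.density_pos[of "T x"] by simp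
  qed
  show "((\<lambda>x. v (T x)) has_field_derivative w' x) (at x)" for x
    unfolding w'_def by (rule DERIV_chain2[OF v(1) T_DERIV])
  show w'c: "continuous_on UNIV w'"
    unfolding w'_def using nz
    by (intro continuous_intros continuous_on_compose2[OF v(2) T_continuous]
        continuous_on_compose2[OF \<mu>2.density_continuous[of UNIV] T_continuous] \<mu>1.density_continuous) auto
  have le: "(w' x)\<^sup>2 \<le> L\<^sup>2 * (d (T x))\<^sup>2" for x
    unfolding w'_def power_mult_distrib using power_mono[OF T'(2,1), of x 2]
    by (subst mult.commute) (intro mult_right_mono, auto)
  have int: "integrable \<mu>1 (\<lambda>x. L\<^sup>2 * (d (T x))\<^sup>2)"
    using L2_integrable_square[OF L2_T[OF v(3)]] by simp
  have meas [measurable]: "w' \<in> borel_measurable borel"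
    by (rule borel_measurable_continuous_onI[OF w'c])
  have int': "integrable \<mu>1 (\<lambda>x. (w' x)\<^sup>2)"
    by (rule Bochner_Integration.integrable_bound[OF int]) (use le in auto)
  then show "w' \<in> L2_space \<mu>1" by (intro \<mu>1.L2I meas)
  have "L2_inner \<mu>1 w' w' \<le> (\<integral>x. L\<^sup>2 * (d (T x))\<^sup>2 \<partial>\<mu>1)"
    unfolding L2_inner_def power2_eq_square[symmetric, of "w' _"] using int' int le by (rule integral_mono)
  also have "\<dots> = L\<^sup>2 * L2_inner \<mu>2 d d"
    using L2_inner_T[OF v(3)] by (simp add: L2_inner_def power2_eq_square)
  finally show "L2_inner \<mu>1 w' w' \<le> L\<^sup>2 * L2_inner \<mu>2 d d" .
qed

end


section \<open>Dimensions of spectral subspaces\<close>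

lemma L2_independent_mono:
  assumes "L2_independent M n g" "k \<le> n"
  shows "L2_independent M k g"
  unfolding L2_independent_def
proof (intro allI impI)
  fix c :: "nat \<Rightarrow> real" and i
  assume c: "AE x in M. (\<Sum>i<k. c i * g i x) = 0" and "i < k"
  define c' where "c' i = (if i < k then c i else 0)" for i
  have "(\<Sum>i<n. c' i * g i x) = (\<Sum>i<k. c i * g i x)" for x
    using \<open>k \<le> n\<close> by (intro sum.mono_neutral_cong_right) (auto simp: c'_def)
  then have "AE x in M. (\<Sum>i<n. c' i * g i x) = 0" using c by simp
  then have "c' i = 0" using assms \<open>i < k\<close> unfolding L2_independent_def by auto
  then show "c i = 0" using \<open>i < k\<close> by (simp add: c'_def)
qed

text \<open>Initial segments of independent families are independent, so if none has length
  \<open>k\<close>, all have length at most \<open>k - 1\<close>; this bound passes to the supremum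
  and stays strictly below \<open>k\<close>.\<close>

lemma L2_dim_less_iff:
  assumes "k \<ge> 1"
  shows "L2_dim M S < enat k \<longleftrightarrow> (\<nexists>g. (\<forall>i<k. g i \<in> S) \<and> L2_independent M k g)"
proof
  assume "L2_dim M S < enat k"
  then show "\<nexists>g. (\<forall>i<k. g i \<in> S) \<and> L2_independent M k g"
    unfolding L2_dim_def by (auto simp: not_le[symmetric] intro: SUP_upper)
next
  assume none: "\<nexists>g. (\<forall>i<k. g i \<in> S) \<and> L2_independent M k g"
  have "L2_dim M S \<le> enat (k - 1)"
    unfolding L2_dim_def
  proof (rule SUP_least)
    fix n assume "n \<in> {n. \<exists>g. (\<forall>i<n. g i \<in> S) \<and> L2_independent M n g}"
    then obtain g where g: "\<forall>i<n. g i \<in> S" "L2_independent M n g" by blast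
    have "n < k"
    proof (rule ccontr)
      assume "\<not> n < k"
      then have "\<forall>i<k. g i \<in> S" "L2_independent M k g"
        using g L2_independent_mono[OF g(2), of k] by auto
      then show False using none by blast
    qed
    then show "enat n \<le> enat (k - 1)" by simp
  qed
  also have "\<dots> < enat k" using assms by simp
  finally show "L2_dim M S < enat k" .
qed

section \<open>Min-max comparison of the two spectra\<close>

theorem theorem1p5:
  fixes \<mu>1 \<mu>2 :: "real measure"
    and f1 f2 :: "real \<Rightarrow> real"
    and L :: real
    and A1 A2 :: "real L2_operator"
    and E1 E2 :: "real \<Rightarrow> (real \<Rightarrow> real) \<Rightarrow> (real \<Rightarrow> real)"
  assumes "prob_space \<mu>1" and "prob_space \<mu>2"
    and "smooth_positive_density \<mu>1 f1" and "smooth_positive_density \<mu>2 f2"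
    and "self_adjoint_laplacian \<mu>1 f1 A1" and "spectral_decomposition \<mu>1 A1 E1"
    and "self_adjoint_laplacian \<mu>2 f2 A2" and "spectral_decomposition \<mu>2 A2 E2"
    and "L > 0"
    and "\<forall>v \<in> {0..1}. flat_profile \<mu>2 f2 v \<ge> (1 / L) * flat_profile \<mu>1 f1 v"
  shows "\<forall>k\<ge>1. spectral_lambda \<mu>2 E2 k \<ge> ereal (1 / L\<^sup>2) * spectral_lambda \<mu>1 E1 k"
proof (intro allI impI)
  fix k :: nat assume "k \<ge> 1"
  interpret l1: laplacian_line \<mu>1 f1 A1 E1
    using assms(1,3,5,6)
    by (intro laplacian_line.intro weighted_line.intro weighted_line_axioms.intro
        spectral_operator.intro laplacian_line_axioms.intro)
  interpret l2: laplacian_line \<mu>2 f2 A2 E2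
    using assms(2,4,7,8)
    by (intro laplacian_line.intro weighted_line.intro weighted_line_axioms.intro
        spectral_operator.intro laplacian_line_axioms.intro)
  interpret transport \<mu>1 f1 \<mu>2 f2 ..
  have dim: "L2_dim \<mu>2 (E2 s ` L2_space \<mu>2) < enat k"
    if t: "L2_dim \<mu>1 (E1 t ` L2_space \<mu>1) < enat k" and "s < 1 / L\<^sup>2 * t" for s t
  proof (rule ccontr)
    assume "\<not> L2_dim \<mu>2 (E2 s ` L2_space \<mu>2) < enat k"
    then obtain g where g: "\<And>i. i < k \<Longrightarrow> g i \<in> E2 s ` L2_space \<mu>2" and indep: "L2_independent \<mu>2 k g"
      using L2_dim_less_iff[OF \<open>k \<ge> 1\<close>] by blast
    have gL: "g i \<in> L2_space \<mu>2" and Eg: "AE x in \<mu>2. E2 s (g i) x = g i x" if "i < k" for i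
      using g[OF that] l2.E_E[of _ s s] by auto
    have gTL: "(\<lambda>x. g i (T x)) \<in> L2_space \<mu>1" if "i < k" for i
      by (rule L2_T[OF gL[OF that]])
    \<comment> \<open>The \<open>k\<close> projected pullbacks live in a space of dimension below
      \<open>k\<close>. A dependence among them supplies coefficients \<open>c\<close> for which the
      pullback of the combination \<open>u\<close> is annihilated by \<open>E1 t\<close>, while
      \<open>u\<close> stays in the range of \<open>E2 s\<close>.\<close>
    have "\<not> L2_independent \<mu>1 k (\<lambda>i. E1 t (\<lambda>x. g i (T x)))"
    proof
      assume "L2_independent \<mu>1 k (\<lambda>i. E1 t (\<lambda>x. g i (T x)))"
      moreover have "\<forall>i<k. E1 t (\<lambda>x. g i (T x)) \<in> E1 t ` L2_space \<mu>1"
        using gTL by (intro allI impI imageI)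
      ultimately have "\<exists>g. (\<forall>i<k. g i \<in> E1 t ` L2_space \<mu>1) \<and> L2_independent \<mu>1 k g"
        by (intro exI[of _ "\<lambda>i. E1 t (\<lambda>x. g i (T x))"] conjI)
      with t[unfolded L2_dim_less_iff[OF \<open>k \<ge> 1\<close>]] show False by (rule notE)
    qed
    then obtain c where c: "AE x in \<mu>1. (\<Sum>i<k. c i * E1 t (\<lambda>x. g i (T x)) x) = 0" and c0: "\<exists>i<k. c i \<noteq> 0"
      unfolding L2_independent_def by blast
    define u where "u x = (\<Sum>i<k. c i * g i x)" for x
    have uL: "u \<in> L2_space \<mu>2" unfolding u_def[abs_def] using gL by (rule L2_sum)
    have "AE x in \<mu>2. \<forall>i\<in>{..<k}. E2 s (g i) x = g i x"
      using Eg by (intro AE_finite_allI) auto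
    moreover have "AE x in \<mu>2. E2 s u x = (\<Sum>i<k. c i * E2 s (g i) x)"
      unfolding u_def[abs_def] using gL by (rule l2.E_sum)
    ultimately have Eu: "AE x in \<mu>2. E2 s u x = u x"
      by eventually_elim (simp add: u_def)
    obtain v d where v: "\<And>x. (v has_field_derivative d x) (at x)" "continuous_on UNIV d"
      "v \<in> L2_space \<mu>2" "d \<in> L2_space \<mu>2" "AE x in \<mu>2. u x = v x"
      and upper: "L2_inner \<mu>2 d d \<le> s * L2_inner \<mu>2 v v"
      using l2.energy_le_on_spectral_subspace[OF uL Eu] by blast
    obtain w' where w': "\<And>x. ((\<lambda>x. v (T x)) has_field_derivative w' x) (at x)" "continuous_on UNIV w'"
      "w' \<in> L2_space \<mu>1" and le: "L2_inner \<mu>1 w' w' \<le> L\<^sup>2 * L2_inner \<mu>2 d d"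
      using energy_T[OF v(1,2,4) assms(9)] assms(10) by force
    have "AE x in \<mu>1. E1 t (\<lambda>x. u (T x)) x = 0"
    proof -
      have "AE x in \<mu>1. E1 t (\<lambda>x. u (T x)) x = (\<Sum>i<k. c i * E1 t (\<lambda>x. g i (T x)) x)"
        unfolding u_def using gTL by (rule l1.E_sum)
      with c show ?thesis by eventually_elim simp
    qed
    \<comment> \<open>Energies need the C^1 representative \<open>v\<close> of \<open>u\<close>;
      exceptional sets pull back to null sets because \<open>T\<close> carries \<open>\<mu>1\<close>
      to \<open>\<mu>2\<close>.\<close>
    moreover have "AE x in \<mu>1. E1 t (\<lambda>x. u (T x)) x = E1 t (\<lambda>x. v (T x)) x"
      by (intro l1.E_cong_AE L2_T uL v AE_T)
    ultimately have "AE x in \<mu>1. E1 t (\<lambda>x. v (T x)) x = 0" by eventually_elim simp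
    then have "t * L2_inner \<mu>1 (\<lambda>x. v (T x)) (\<lambda>x. v (T x)) \<le> L2_inner \<mu>1 w' w'"
      by (rule l1.energy_ge_on_orthogonal_complement[OF w'(1,2) L2_T[OF v(3)] w'(3)])
    also note le
    also have "L\<^sup>2 * L2_inner \<mu>2 d d \<le> L\<^sup>2 * (s * L2_inner \<mu>2 v v)"
      using upper by (intro mult_left_mono) auto
    \<comment> \<open>The strict inequality between \<open>s\<close> and \<open>t / L^2\<close>
      makes the coefficient positive, so \<open>v\<close> has norm 0, against the independence of
      the \<open>g i\<close>.\<close>
    finally have "(t - L\<^sup>2 * s) * L2_inner \<mu>2 v v \<le> 0"
      by (simp add: L2_inner_T[OF v(3)] algebra_simps)
    moreover have "0 < t - L\<^sup>2 * s"
      using \<open>s < 1 / L\<^sup>2 * t\<close> \<open>L > 0\<close> by (simp add: field_simps)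
    ultimately have "L2_inner \<mu>2 v v = 0"
      using L2_inner_self_nonneg[of \<mu>2 v] by (simp add: mult_le_0_iff)
    then have "AE x in \<mu>2. v x = 0" by (simp add: L2_inner_self_eq_0_iff[OF v(3)])
    then have "AE x in \<mu>2. (\<Sum>i<k. c i * g i x) = 0"
      using v(5) unfolding u_def by eventually_elim simp
    then have "\<forall>i<k. c i = 0" using indep unfolding L2_independent_def by blast
    then show False using c0 by blast
  qed
  have "ereal (1 / L\<^sup>2) * ereal t \<le> spectral_lambda \<mu>2 E2 k"
    if "L2_dim \<mu>1 (E1 t ` L2_space \<mu>1) < enat k" for t
  proof (rule ccontr)
    assume "\<not> ?thesis"
    then have "spectral_lambda \<mu>2 E2 k < ereal (1 / L\<^sup>2 * t)" by simp
    \<comment> \<open>A real \<open>s\<close> strictly in between is admissible in the supremum for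
      \<open>\<mu>2\<close> by \<open>dim\<close>, yet exceeds it.\<close>
    then obtain s where s: "spectral_lambda \<mu>2 E2 k < ereal s" "s < 1 / L\<^sup>2 * t"
      using ereal_dense2 by force
    then have "ereal s \<le> spectral_lambda \<mu>2 E2 k"
      unfolding spectral_lambda_def using dim[OF that] by (intro SUP_upper) simp
    then show False using s by simp
  qed
  \<comment> \<open>Dividing by a positive finite factor reduces the claim to a bound on each
    \<open>t\<close> in the supremum for \<open>\<mu>1\<close>, which also covers an empty or
    unbounded set of levels.\<close>
  moreover have "0 < ereal (1 / L\<^sup>2)" "ereal (1 / L\<^sup>2) \<noteq> \<infinity>" using \<open>L > 0\<close> by auto
  note iff = ereal_le_divide_pos[OF this]
  ultimately show "ereal (1 / L\<^sup>2) * spectral_lambda \<mu>1 E1 k \<le> spectral_lambda \<mu>2 E2 k"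
    unfolding iff[symmetric] by (subst spectral_lambda_def) (auto intro: SUP_least)
qed

end
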